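(* Let $n\ge 2$, let $2 \le d \le n$ be even with $d=2e$, let $t=\lfloor n/2 \rfloor$, and let $1 \le k \le \frac{n(n-1)}{2t}(t-e+1)$. Then $$\delta_q^{\mathrm{Alt}}(n \times n, k, d) \in O\left(q^{n(n-1)/2-k+1-(d-2)n+(d-1)(d-2)/2}\right) \quad \text{as } q \to +\infty.$$ Moreover, $\lim_{q \to+\infty}\delta^{\mathrm{Alt}}_q(n \times n,k,d)=1$ if $k < \frac{n(n-1)}{2}+1-(d-2)n+\frac{(d-1)(d-2)}{2}$, and $=0$ if $k > \frac{n(n-1)}{2}+1-(d-2)n+\frac{(d-1)(d-2)}{2}$.
   Context: $\mathrm{Alt}_n(q)$ is the $\mathbb{F}_q$-space (of dimension $n(n-1)/2$) of alternating $n\times n$ matrices over $\mathbb{F}_q$ ($M_{ij}=-M_{ji}$, $M_{ii}=0$). $\delta^{\mathrm{Alt}}_q(n\times n,k,d)$ is the number of $k$-dimensional $\mathbb{F}_q$-subspaces of $\mathrm{Alt}_n(q)$ in which every nonzero matrix has rank at least $d$, divided by the number of all $k$-dimensional subspaces of $\mathrm{Alt}_n(q)$. Limits are over prime powers $q$ with $n,k,d$ fixed. *)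

theory Defs
  imports
    "Jordan_Normal_Form.Missing_VectorSpace"
    "HOL-Number_Theory.Prime_Powers"
    "HOL-Library.Landau_Symbols"
    Complex_Main
begin

text \<open>
  Here an \<open>n \<times> n\<close> matrix over \<open>R\<close> is an extensional function on \<open>{..<n} \<times> {..<n}\<close> with values in
  the carrier, i.e. an element of \<open>ring.func_space R ({..<n} \<times> {..<n})\<close>, whose module structure is
  the entrywise one.  The fields are carrier-based because the theorem lets the field vary.
\<close>

definition mat_space :: "'a ring \<Rightarrow> nat \<Rightarrow> ('a, nat \<times> nat \<Rightarrow> 'a) module" where
  "mat_space R n = ring.func_space R ({..<n} \<times> {..<n})"

definition alt_mats :: "'a ring \<Rightarrow> nat \<Rightarrow> (nat \<times> nat \<Rightarrow> 'a) set" where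
  "alt_mats R n = {M \<in> carrier (mat_space R n).
     (\<forall>i<n. \<forall>j<n. M (i, j) = \<ominus>\<^bsub>R\<^esub> M (j, i)) \<and> (\<forall>i<n. M (i, i) = \<zero>\<^bsub>R\<^esub>)}"

definition alt_space :: "'a ring \<Rightarrow> nat \<Rightarrow> ('a, nat \<times> nat \<Rightarrow> 'a) module" where
  "alt_space R n = (mat_space R n)\<lparr>carrier := alt_mats R n\<rparr>"

definition mat_column :: "nat \<Rightarrow> (nat \<times> nat \<Rightarrow> 'a) \<Rightarrow> nat \<Rightarrow> (nat \<Rightarrow> 'a)" where
  "mat_column n M j = (\<lambda>i\<in>{..<n}. M (i, j))"

definition mat_rank :: "'a ring \<Rightarrow> nat \<Rightarrow> (nat \<times> nat \<Rightarrow> 'a) \<Rightarrow> nat" where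
  "mat_rank R n M =
     (let V = ring.func_space R {..<n}
      in vectorspace.dim R
           (V\<lparr>carrier := LinearCombinations.module.span R V (mat_column n M ` {..<n})\<rparr>))"

definition alt_subspaces :: "'a ring \<Rightarrow> nat \<Rightarrow> nat \<Rightarrow> (nat \<times> nat \<Rightarrow> 'a) set set" where
  "alt_subspaces R n k =
     {W. VectorSpace.subspace R W (alt_space R n) \<and>
         vectorspace.dim R ((alt_space R n)\<lparr>carrier := W\<rparr>) = k}"

definition delta_Alt :: "'a ring \<Rightarrow> nat \<Rightarrow> nat \<Rightarrow> nat \<Rightarrow> real" where
  "delta_Alt R n k d =
     real (card {W \<in> alt_subspaces R n k.
                   \<forall>M\<in>W. M \<noteq> \<zero>\<^bsub>alt_space R n\<^esub> \<longrightarrow> d \<le> mat_rank R n M})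
     / real (card (alt_subspaces R n k))"

definition prime_powers_at_top :: "nat filter" where
  "prime_powers_at_top = inf at_top (principal {q. primepow q})"

end

theory Submission
  imports Defs
begin

text \<open>
  Let \<open>X\<close> be the number of nonzero alternating matrices of rank below \<open>d\<close> in a random
  \<open>k\<close>-dimensional subspace.  A nonzero vector lies in such a subspace with probability
  \<open>p = (q^k - 1) / (q^N - 1)\<close>, where \<open>N = n (n - 1) / 2\<close>, and two independent vectors do so with
  probability at most \<open>p^2\<close>.  The first moment of \<open>X\<close>, together with the fact that \<open>X\<close> is at least
  \<open>q - 1\<close> as soon as it is nonzero, bounds \<open>1 - \<delta>\<close>; the second moment (Chebyshev) bounds \<open>\<delta>\<close>.
  The number of matrices of low rank is found up to constant factors by symplectic elimination: if
  \<open>M (i, j)\<close> is nonzero, then \<open>M\<close> is determined by its rows \<open>i\<close> and \<open>j\<close> and by its Schur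
  complement, an alternating matrix whose rank is smaller by \<open>2\<close>.
\<close>

section \<open>Subspaces of a finite vector space\<close>

text \<open>A vector v and its multiples lie in the same subspaces, so membership is not pairwise
  independent over the low-rank matrices; the variance of X picks up a factor q - 1 from this. Both
  moment bounds are therefore governed by the expected number of low-rank lines, which is of order
  q^(D + k - N - 1), where D is given by \<open>low_rank_dim\<close>. Its exponent is -x for the
  exponent x of the theorem: delta is O(q^x), 1 - delta is O(q^(-x)), and the sign of x decides the
  limit.

  Rank is measured by cardinality: a space of dimension m has q^m elements. A Schur step then
  divides the size of the column space by exactly q^2, and the evenness of alternating ranks comes
  out of the elimination itself. Since constants may depend on n and d, it is harmless that the
  upper count treats a matrix once for every possible pivot position.\<close>

locale finite_vectorspace = vectorspace +
  assumes finite_K: "finite (carrier K)" and finite_V: "finite (carrier V)"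
begin

lemma card_K_ge_2: "2 \<le> card (carrier K)"
proof -
  have "card {\<zero>\<^bsub>K\<^esub>, \<one>\<^bsub>K\<^esub>} \<le> card (carrier K)"
    by (rule card_mono) (auto simp: finite_K)
  then show ?thesis by simp
qed

section \<open>Cardinality in place of dimension\<close>

lemma finite_span_subset: "S \<subseteq> carrier V \<Longrightarrow> finite (span S)"
  using finite_V span_is_subset2 finite_subset by blast

lemma span_insert_eq:
  assumes S: "S \<subseteq> carrier V" and x: "x \<in> carrier V"
  shows "span (insert x S) = (\<lambda>(c, w). c \<odot>\<^bsub>V\<^esub> x \<oplus>\<^bsub>V\<^esub> w) ` (carrier K \<times> span S)"
    (is "_ = ?A")
proof
  have sm: "submodule K (span S) V" by (rule span_is_submodule[OF S])
  have car: "\<And>w. w \<in> span S \<Longrightarrow> w \<in> carrier V" using span_is_subset2[OF S] by blast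
  have "submodule K ?A V"
  proof (rule submodule.intro)
    show "Module.module K V" ..
    show "?A \<subseteq> carrier V" using x car by auto
    show "\<zero>\<^bsub>V\<^esub> \<in> ?A"
      by (rule image_eqI[of _ _ "(\<zero>\<^bsub>K\<^esub>, \<zero>\<^bsub>V\<^esub>)"]) (use x span_zero in auto)
  next
    fix v w assume "v \<in> ?A" "w \<in> ?A"
    then obtain c a d b where *: "c \<in> carrier K" "d \<in> carrier K" "a \<in> span S" "b \<in> span S"
      "v = c \<odot>\<^bsub>V\<^esub> x \<oplus>\<^bsub>V\<^esub> a" "w = d \<odot>\<^bsub>V\<^esub> x \<oplus>\<^bsub>V\<^esub> b" by auto
    have "v \<oplus>\<^bsub>V\<^esub> w = (c \<oplus>\<^bsub>K\<^esub> d) \<odot>\<^bsub>V\<^esub> x \<oplus>\<^bsub>V\<^esub> (a \<oplus>\<^bsub>V\<^esub> b)"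
      using * x car by (simp add: smult_l_distr M.a_ac)
    moreover have "a \<oplus>\<^bsub>V\<^esub> b \<in> span S" using * S span_add1 by blast
    ultimately show "v \<oplus>\<^bsub>V\<^esub> w \<in> ?A"
      using * by (intro image_eqI[of _ _ "(c \<oplus>\<^bsub>K\<^esub> d, a \<oplus>\<^bsub>V\<^esub> b)"]) auto
  next
    fix c v assume c: "c \<in> carrier K" and "v \<in> ?A"
    then obtain d a where *: "d \<in> carrier K" "a \<in> span S" "v = d \<odot>\<^bsub>V\<^esub> x \<oplus>\<^bsub>V\<^esub> a" by auto
    have "c \<odot>\<^bsub>V\<^esub> v = (c \<otimes>\<^bsub>K\<^esub> d) \<odot>\<^bsub>V\<^esub> x \<oplus>\<^bsub>V\<^esub> c \<odot>\<^bsub>V\<^esub> a"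
      using * x c car by (simp add: smult_r_distr smult_assoc1)
    moreover have "c \<odot>\<^bsub>V\<^esub> a \<in> span S" using submodule.smult_closed[OF sm] * c by blast
    ultimately show "c \<odot>\<^bsub>V\<^esub> v \<in> ?A"
      using * c by (intro image_eqI[of _ _ "(c \<otimes>\<^bsub>K\<^esub> d, c \<odot>\<^bsub>V\<^esub> a)"]) auto
  qed
  moreover have "insert x S \<subseteq> ?A"
  proof -
    have "x = \<one>\<^bsub>K\<^esub> \<odot>\<^bsub>V\<^esub> x \<oplus>\<^bsub>V\<^esub> \<zero>\<^bsub>V\<^esub>" using x by simp
    then have "x \<in> ?A" using span_zero by (intro image_eqI[of _ _ "(\<one>\<^bsub>K\<^esub>, \<zero>\<^bsub>V\<^esub>)"]) auto
    moreover have "s \<in> ?A" if "s \<in> S" for s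
    proof -
      have "s = \<zero>\<^bsub>K\<^esub> \<odot>\<^bsub>V\<^esub> x \<oplus>\<^bsub>V\<^esub> s" using x that S by auto
      then show ?thesis using that S span_mem
        by (intro image_eqI[of _ _ "(\<zero>\<^bsub>K\<^esub>, s)"]) auto
    qed
    ultimately show ?thesis by auto
  qed
  ultimately show "span (insert x S) \<subseteq> ?A" by (intro span_is_subset)
  have sm': "submodule K (span (insert x S)) V" by (rule span_is_submodule) (use S x in auto)
  have "x \<in> span (insert x S)" by (rule span_mem) (use S x in auto)
  moreover have "span S \<subseteq> span (insert x S)" by (rule span_is_monotone) auto
  ultimately show "?A \<subseteq> span (insert x S)"
    using submodule.smult_closed[OF sm'] submodule.m_closed[OF sm'] by auto
qed

text \<open>The coefficient of x is determined: two representations with different coefficients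
  could be solved for x, which would put x into \<open>span S\<close>. Both the counting of
  independent lists and the effect of a Schur step on the rank rest on this factor.\<close>

lemma card_span_insert:
  assumes S: "S \<subseteq> carrier V" and x: "x \<in> carrier V" and n: "x \<notin> span S"
  shows "card (span (insert x S)) = card (carrier K) * card (span S)"
proof -
  have sm: "submodule K (span S) V" by (rule span_is_submodule[OF S])
  have car: "\<And>w. w \<in> span S \<Longrightarrow> w \<in> carrier V" using span_is_subset2[OF S] by blast
  have "inj_on (\<lambda>(c, w). c \<odot>\<^bsub>V\<^esub> x \<oplus>\<^bsub>V\<^esub> w) (carrier K \<times> span S)"
  proof (rule inj_onI, clarsimp)
    fix c a d b
    assume *: "c \<in> carrier K" "d \<in> carrier K" "a \<in> span S" "b \<in> span S"
      and eq: "c \<odot>\<^bsub>V\<^esub> x \<oplus>\<^bsub>V\<^esub> a = d \<odot>\<^bsub>V\<^esub> x \<oplus>\<^bsub>V\<^esub> b"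
    have "c = d"
    proof (rule ccontr)
      assume "c \<noteq> d"
      let ?e = "c \<ominus>\<^bsub>K\<^esub> d"
      have e: "?e \<in> carrier K" "?e \<noteq> \<zero>\<^bsub>K\<^esub>" using * \<open>c \<noteq> d\<close> by auto
      have "?e \<odot>\<^bsub>V\<^esub> x = c \<odot>\<^bsub>V\<^esub> x \<ominus>\<^bsub>V\<^esub> d \<odot>\<^bsub>V\<^esub> x"
        using * x by (simp add: a_minus_def smult_l_distr smult_l_minus)
      also have "\<dots> = b \<ominus>\<^bsub>V\<^esub> a"
      proof -
        have "c \<odot>\<^bsub>V\<^esub> x = d \<odot>\<^bsub>V\<^esub> x \<oplus>\<^bsub>V\<^esub> b \<ominus>\<^bsub>V\<^esub> a"
          using eq * x car M.add.inv_solve_right'[of "c \<odot>\<^bsub>V\<^esub> x" "d \<odot>\<^bsub>V\<^esub> x \<oplus>\<^bsub>V\<^esub> b" a]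
          by (metis M.add.inv_solve_right M.add.m_closed a_minus_def smult_closed)
        then show ?thesis using * x car
          by (simp add: a_minus_def M.a_ac M.r_neg M.r_neg1 M.r_neg2)
      qed
      finally have "?e \<odot>\<^bsub>V\<^esub> x \<in> span S"
        using * S span_neg span_add1 by (simp add: a_minus_def)
      then have "inv\<^bsub>K\<^esub> ?e \<odot>\<^bsub>V\<^esub> (?e \<odot>\<^bsub>V\<^esub> x) \<in> span S"
        using submodule.smult_closed[OF sm] e by auto
      moreover have "x = inv\<^bsub>K\<^esub> ?e \<odot>\<^bsub>V\<^esub> (?e \<odot>\<^bsub>V\<^esub> x)"
        by (rule mult_inverse[OF e(1) x refl e(2)])
      ultimately show False using n by simp
    qed
    then show "c = d \<and> a = b" using eq * x car by auto
  qed
  then show ?thesis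
    unfolding span_insert_eq[OF S x] by (simp add: card_image card_cartesian_product)
qed

lemma card_span_lin_indpt:
  assumes "finite S" "S \<subseteq> carrier V" "lin_indpt S"
  shows "card (span S) = card (carrier K) ^ card S"
  using assms
proof (induction S rule: finite_induct)
  case empty
  then show ?case by (simp add: span_empty)
next
  case (insert x S)
  have li: "lin_indpt S" using insert.prems subset_li_is_li by blast
  then have "x \<notin> span S"
    using lin_dep_iff_in_span[of S x] insert by auto
  then show ?case using insert li card_span_insert[of S x] by simp
qed

lemma card_carrier: "card (carrier V) = card (carrier K) ^ dim"
proof -
  have "fin_dim" unfolding fin_dim_def
    using finite_V in_own_span[of "carrier V"] span_is_subset2[of "carrier V"] by blast
  then obtain b where b: "finite b" "basis b" using finite_basis_exists by blast
  then show ?thesis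
    using card_span_lin_indpt[of b] dim_basis[of b] by (simp add: basis_def)
qed

lemma subspace_subset: "VectorSpace.subspace K W V \<Longrightarrow> W \<subseteq> carrier V"
  using submodule.subset unfolding VectorSpace.subspace_def by blast

lemma card_subspace:
  assumes "VectorSpace.subspace K W V"
  shows "card W = card (carrier K) ^ vectorspace.dim K (vs W)"
proof -
  interpret W: vectorspace K "vs W" by (rule subspace_is_vs[OF assms])
  interpret W: finite_vectorspace K "vs W"
    using subspace_subset[OF assms] finite_V finite_K
    by unfold_locales (auto intro: finite_subset)
  show ?thesis using W.card_carrier by simp
qed

text \<open>With q >= 2 the powers of q are distinct, so the size of a subspace determines its
  dimension and the counting can be done with cardinalities.\<close>

lemma dim_subspace_eq_iff:
  assumes "VectorSpace.subspace K W V"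
  shows "vectorspace.dim K (vs W) = k \<longleftrightarrow> card W = card (carrier K) ^ k"
  using card_subspace[OF assms] card_K_ge_2 by simp

section \<open>Subspaces containing given independent vectors\<close>

primrec indep_list :: "'c list \<Rightarrow> bool" where
  "indep_list [] \<longleftrightarrow> True"
| "indep_list (x # xs) \<longleftrightarrow> x \<in> carrier V - span (set xs) \<and> indep_list xs"

lemma indep_list_subset: "indep_list xs \<Longrightarrow> set xs \<subseteq> carrier V"
  by (induction xs) auto

lemma card_span_indep_list:
  "indep_list xs \<Longrightarrow> card (span (set xs)) = card (carrier K) ^ length xs"
  by (induction xs) (auto simp: span_empty card_span_insert indep_list_subset)

text \<open>New vectors are put in front of \<open>ys\<close>, the side on which
  \<open>indep_list\<close> grows; ordered lists, unlike bases as sets, allow the vectors to be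
  chosen one at a time.\<close>

definition indep_extensions :: "'c set \<Rightarrow> 'c list \<Rightarrow> nat \<Rightarrow> 'c list set" where
  "indep_extensions U ys m = {xs. length xs = m \<and> set xs \<subseteq> U \<and> indep_list (xs @ ys)}"

text \<open>Whatever i vectors were chosen so far span exactly q^i elements of U, so the number of
  next choices depends on i alone. Once U is exhausted the factor is 0, so truncated subtraction
  does no harm.\<close>

lemma card_indep_extensions:
  assumes U: "VectorSpace.subspace K U V" and ys: "indep_list ys" "set ys \<subseteq> U"
  shows "finite (indep_extensions U ys m) \<and> card (indep_extensions U ys m)
    = (\<Prod>i = length ys..<length ys + m. card U - card (carrier K) ^ i)"
proof (induction m)
  case 0
  have "indep_extensions U ys 0 = {[]}" using ys by (auto simp: indep_extensions_def)
  then show ?case by simp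
next
  case (Suc m)
  let ?S = "SIGMA xs:indep_extensions U ys m. U - span (set (xs @ ys))"
  have UV: "U \<subseteq> carrier V" by (rule subspace_subset[OF U])
  have fU: "finite U" using UV finite_V finite_subset by blast
  have eq: "indep_extensions U ys (Suc m) = (\<lambda>(xs, x). x # xs) ` ?S" (is "?L = ?R")
  proof
    show "?L \<subseteq> ?R"
    proof
      fix zs assume zs: "zs \<in> ?L"
      then obtain x xs where "zs = x # xs"
        by (cases zs) (auto simp: indep_extensions_def)
      then show "zs \<in> ?R" using zs
        by (intro image_eqI[of _ _ "(xs, x)"]) (auto simp: indep_extensions_def)
    qed
    show "?R \<subseteq> ?L" using UV by (auto simp: indep_extensions_def)
  qed
  have inj: "inj_on (\<lambda>(xs, x). x # xs) ?S" by (auto simp: inj_on_def)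
  have c: "card (U - span (set (xs @ ys))) = card U - card (carrier K) ^ (length ys + m)"
    if "xs \<in> indep_extensions U ys m" for xs
  proof -
    have sub: "set (xs @ ys) \<subseteq> U" and ind: "indep_list (xs @ ys)" and l: "length xs = m"
      using that ys by (auto simp: indep_extensions_def)
    have "span (set (xs @ ys)) \<subseteq> U"
      by (rule span_is_subset[OF sub]) (use U in \<open>simp add: VectorSpace.subspace_def\<close>)
    then show ?thesis
      using card_Diff_subset[of "span (set (xs @ ys))" U] card_span_indep_list[OF ind] fU l
      by (simp add: finite_subset add.commute)
  qed
  have "card ?S = card (indep_extensions U ys m) * (card U - card (carrier K) ^ (length ys + m))"
    using Suc c fU by (subst card_SigmaI) auto
  moreover have "finite ?S" using Suc fU by auto
  ultimately show ?case
    unfolding eq card_image[OF inj] using Suc by simp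
qed

definition subspaces :: "nat \<Rightarrow> 'c set set" where
  "subspaces k = {W. VectorSpace.subspace K W V \<and> vectorspace.dim K (vs W) = k}"

lemma finite_subspaces: "finite (subspaces k)"
  by (rule finite_subset[of _ "Pow (carrier V)"])
    (use finite_V subspace_subset in \<open>auto simp: subspaces_def\<close>)

text \<open>Double counting of the pairs of a subspace W and a completion of \<open>ys\<close> to an
  ordered basis of W. Such a completion spans W and so belongs to one W only; the completions inside
  the whole space split into classes of equal size.\<close>

lemma card_subspaces_containing:
  assumes ys: "indep_list ys" and l: "length ys \<le> k"
  shows "card {W \<in> subspaces k. set ys \<subseteq> W}
      * (\<Prod>i = length ys..<k. card (carrier K) ^ k - card (carrier K) ^ i)
    = (\<Prod>i = length ys..<k. card (carrier V) - card (carrier K) ^ i)"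
proof -
  let ?A = "{W \<in> subspaces k. set ys \<subseteq> W}" and ?m = "k - length ys"
  have sV: "VectorSpace.subspace K (carrier V) V"
    unfolding VectorSpace.subspace_def submodule_def by (auto intro!: vectorspace_axioms module_axioms)
  have sm: "VectorSpace.subspace K W V" "card W = card (carrier K) ^ k" if "W \<in> ?A" for W
    using that card_subspace by (auto simp: subspaces_def)
  have spanW: "span (set (xs @ ys)) = W" if "W \<in> ?A" "xs \<in> indep_extensions W ys ?m" for W xs
  proof (rule card_subset_eq)
    show "finite W" using sm(1)[OF that(1)] subspace_subset finite_V finite_subset by blast
    show "span (set (xs @ ys)) \<subseteq> W"
      by (rule span_is_subset) (use that sm in \<open>auto simp: indep_extensions_def VectorSpace.subspace_def\<close>)
    show "card (span (set (xs @ ys))) = card W"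
      using that l card_span_indep_list[of "xs @ ys"] sm(2)[OF that(1)]
      by (simp add: indep_extensions_def)
  qed
  have eq: "indep_extensions (carrier V) ys ?m = (\<Union>W\<in>?A. indep_extensions W ys ?m)" (is "?L = ?R")
  proof
    show "?R \<subseteq> ?L"
      using sm subspace_subset by (fastforce simp: indep_extensions_def)
    show "?L \<subseteq> ?R"
    proof
      fix xs assume xs: "xs \<in> ?L"
      then have ind: "indep_list (xs @ ys)" and len: "length xs = ?m"
        by (auto simp: indep_extensions_def)
      let ?W = "span (set (xs @ ys))"
      have car: "set (xs @ ys) \<subseteq> carrier V" using indep_list_subset[OF ind] .
      have W: "VectorSpace.subspace K ?W V" by (rule span_is_subspace[OF car])
      have "card ?W = card (carrier K) ^ k" using card_span_indep_list[OF ind] len l by simp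
      then have "?W \<in> subspaces k" using W dim_subspace_eq_iff[OF W] by (simp add: subspaces_def)
      moreover have "set (xs @ ys) \<subseteq> ?W" by (rule in_own_span[OF car])
      ultimately show "xs \<in> ?R" using ind len
        by (intro UN_I[of ?W]) (auto simp: indep_extensions_def)
    qed
  qed
  have "card ?L = (\<Sum>W\<in>?A. card (indep_extensions W ys ?m))"
    unfolding eq
  proof (rule card_UN_disjoint)
    show "finite ?A" using finite_subspaces by simp
    show "\<forall>W\<in>?A. finite (indep_extensions W ys ?m)"
      using card_indep_extensions[OF sm(1) ys] by auto
    show "\<forall>W\<in>?A. \<forall>W'\<in>?A. W \<noteq> W' \<longrightarrow> indep_extensions W ys ?m \<inter> indep_extensions W' ys ?m = {}"
      using spanW by (metis (no_types, lifting) disjoint_iff)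
  qed
  also have "\<dots> = (\<Sum>W\<in>?A. \<Prod>i = length ys..<k. card (carrier K) ^ k - card (carrier K) ^ i)"
    using card_indep_extensions[OF sm(1) ys] sm(2) l by (intro sum.cong) auto
  finally show ?thesis
    using card_indep_extensions[OF sV ys indep_list_subset[OF ys], of ?m] l by simp
qed

text \<open>Quotient of the counts for \<open>ys\<close> and for the empty list: the factors with
  index at least \<open>length ys\<close> occur in both and cancel.\<close>

lemma card_subspaces_containing_ratio:
  assumes ys: "indep_list ys" and l: "length ys \<le> k" and k: "k \<le> dim"
  shows "real (card {W \<in> subspaces k. set ys \<subseteq> W})
      * (\<Prod>i<length ys. real (card (carrier K)) ^ dim - real (card (carrier K)) ^ i)
    = real (card (subspaces k))
      * (\<Prod>i<length ys. real (card (carrier K)) ^ k - real (card (carrier K)) ^ i)"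
proof -
  let ?q = "card (carrier K)" and ?l = "length ys"
  define P where "P m A = (\<Prod>i\<in>A. real ?q ^ m - real ?q ^ i)" for m :: nat and A :: "nat set"
  \<comment> \<open>For i < k <= m the truncated subtraction of naturals agrees with the real
    one.\<close>
  have conv: "real (\<Prod>i = j..<k. ?q ^ m - ?q ^ i) = P m {j..<k}" if "k \<le> m" for j m
    unfolding P_def of_nat_prod using that card_K_ge_2
    by (intro prod.cong) (auto simp: of_nat_diff intro!: power_increasing)
  have pos: "P k {?l..<k} > 0" unfolding P_def using card_K_ge_2
    by (intro prod_pos) (auto intro!: power_strict_increasing)
  have split: "P m {0..<k} = P m {..<?l} * P m {?l..<k}" for m
    unfolding P_def using l by (simp add: prod.atLeastLessThan_concat lessThan_atLeast0)
  have "real (card {W \<in> subspaces k. set ys \<subseteq> W} * (\<Prod>i = ?l..<k. ?q ^ k - ?q ^ i))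
      = real (\<Prod>i = ?l..<k. ?q ^ dim - ?q ^ i)"
    using card_subspaces_containing[OF ys l] by (simp add: card_carrier)
  then have 1: "real (card {W \<in> subspaces k. set ys \<subseteq> W}) * P k {?l..<k} = P dim {?l..<k}"
    unfolding of_nat_mult using conv[of k ?l] conv[OF k, of ?l] by simp
  have "real (card {W \<in> subspaces k. set [] \<subseteq> W} * (\<Prod>i = 0..<k. ?q ^ k - ?q ^ i))
      = real (\<Prod>i = 0..<k. ?q ^ dim - ?q ^ i)"
    using card_subspaces_containing[of "[]" k] by (simp add: card_carrier)
  then have 2: "real (card (subspaces k)) * P k {0..<k} = P dim {0..<k}"
    unfolding of_nat_mult using conv[of k 0] conv[OF k, of 0] by simp
  have "(real (card {W \<in> subspaces k. set ys \<subseteq> W}) * P dim {..<?l}) * P k {?l..<k}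
      = (real (card (subspaces k)) * P k {..<?l}) * P k {?l..<k}"
    using 1 2 unfolding split by (simp add: algebra_simps)
  then have "real (card {W \<in> subspaces k. set ys \<subseteq> W}) * P dim {..<?l}
      = real (card (subspaces k)) * P k {..<?l}"
    by (subst (asm) mult_right_cancel) (use pos in auto)
  then show ?thesis by (simp add: P_def)
qed

section \<open>First and second moments, and the two tail bounds\<close>

definition incidence_prob :: "nat \<Rightarrow> real" where
  "incidence_prob k = (real (card (carrier K)) ^ k - 1) / (real (card (carrier K)) ^ dim - 1)"

lemma dim_gt_0: "v \<in> carrier V \<Longrightarrow> v \<noteq> \<zero>\<^bsub>V\<^esub> \<Longrightarrow> 0 < dim"
proof (rule ccontr)
  assume v: "v \<in> carrier V" "v \<noteq> \<zero>\<^bsub>V\<^esub>" "\<not> 0 < dim"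
  have "card {v, \<zero>\<^bsub>V\<^esub>} \<le> card (carrier V)" using v finite_V by (intro card_mono) auto
  then show False using card_carrier v by simp
qed

lemma card_subspaces_containing_vector:
  assumes v: "v \<in> carrier V" "v \<noteq> \<zero>\<^bsub>V\<^esub>" and k: "1 \<le> k" "k \<le> dim"
  shows "real (card {W \<in> subspaces k. v \<in> W}) = incidence_prob k * real (card (subspaces k))"
proof -
  have "indep_list [v]" using v by (simp add: span_empty)
  moreover have "real (card (carrier K)) ^ dim > 1"
    using dim_gt_0[OF v] card_K_ge_2 by (intro one_less_power) auto
  ultimately show ?thesis using card_subspaces_containing_ratio[of "[v]" k] k
    by (simp add: incidence_prob_def field_simps)
qed

text \<open>The exact probability for k >= 2 is p (q^k - q) / (q^N - q) with N = \<open>dim\<close>,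
  and the second factor is at most p because k <= N.\<close>

lemma card_subspaces_containing_two_vectors:
  assumes v: "v \<in> carrier V" "v \<noteq> \<zero>\<^bsub>V\<^esub>" and w: "w \<in> carrier V" "w \<notin> span {v}"
    and k: "1 \<le> k" "k \<le> dim"
  shows "real (card {W \<in> subspaces k. v \<in> W \<and> w \<in> W})
    \<le> (incidence_prob k)\<^sup>2 * real (card (subspaces k))"
proof -
  let ?q = "real (card (carrier K))"
  have ind: "indep_list [w, v]" using v w by (simp add: span_empty)
  have sub: "W \<in> subspaces k \<Longrightarrow> v \<in> W \<Longrightarrow> w \<in> W \<Longrightarrow> card (span (set [w, v])) \<le> card W" for W
    using subspace_subset finite_V
    by (intro card_mono span_is_subset)
      (auto simp: subspaces_def VectorSpace.subspace_def intro: finite_subset)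
  have q: "?q \<ge> 2" using card_K_ge_2 by simp
  show ?thesis
  proof (cases "k = 1")
    \<comment> \<open>The ratio formula for two vectors requires k >= 2; a line is too small for the
      q^2 elements of the span of v and w.\<close>
    case True
    have "{W \<in> subspaces k. v \<in> W \<and> w \<in> W} = {}"
    proof (rule ccontr)
      assume "{W \<in> subspaces k. v \<in> W \<and> w \<in> W} \<noteq> {}"
      then obtain W where W: "W \<in> subspaces k" "v \<in> W" "w \<in> W" by auto
      have "card W = card (carrier K)" using W(1) True card_subspace by (auto simp: subspaces_def)
      moreover have "card (span (set [w, v])) = card (carrier K) ^ 2"
        using card_span_indep_list[OF ind] by (simp add: power2_eq_square)
      ultimately show False using sub[OF W] card_K_ge_2 by (simp add: power2_eq_square)
    qed
    then show ?thesis by (simp only: card.empty of_nat_0) simp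
  next
    case False
    have dim: "2 \<le> dim" using False k by simp
    have qd: "?q ^ dim \<ge> ?q ^ k" "?q ^ dim > ?q" "?q ^ dim > 1" "?q ^ k \<ge> ?q"
      using q k dim power_strict_increasing[of 1 dim ?q] power_increasing[of 1 k ?q]
      by (auto intro!: power_increasing one_less_power)
    have *: "c = x / a * (y / b) * s" if "a \<noteq> 0" "b \<noteq> 0" "c * (a * b) = s * (x * y)"
      for a b c s x y :: real
      using that by (simp add: field_simps)
    have "real (card {W \<in> subspaces k. v \<in> W \<and> w \<in> W}) * ((?q ^ dim - 1) * (?q ^ dim - ?q))
        = real (card (subspaces k)) * ((?q ^ k - 1) * (?q ^ k - ?q))"
      using card_subspaces_containing_ratio[OF ind, of k] k False
      by (simp add: numeral_2_eq_2 lessThan_Suc conj_commute mult.commute)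
    then have "real (card {W \<in> subspaces k. v \<in> W \<and> w \<in> W})
        = incidence_prob k * ((?q ^ k - ?q) / (?q ^ dim - ?q)) * real (card (subspaces k))"
      unfolding incidence_prob_def using qd by (intro *) auto
    also have "\<dots> \<le> incidence_prob k * incidence_prob k * real (card (subspaces k))"
    proof (intro mult_right_mono mult_left_mono)
      \<comment> \<open>After clearing denominators, the difference of the two sides of the claim is
        exactly this product.\<close>
      have "0 \<le> (?q ^ dim - ?q ^ k) * (?q - 1)" using qd q by simp
      then show "(?q ^ k - ?q) / (?q ^ dim - ?q) \<le> incidence_prob k"
        unfolding incidence_prob_def using qd by (simp add: field_simps)
      show "0 \<le> incidence_prob k" unfolding incidence_prob_def using qd q by simp
    qed simp
    finally show ?thesis by (simp add: power2_eq_square)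
  qed
qed

lemma sum_card_Int_subspaces:
  assumes S: "S \<subseteq> carrier V - {\<zero>\<^bsub>V\<^esub>}" and k: "1 \<le> k" "k \<le> dim"
  shows "(\<Sum>W\<in>subspaces k. real (card (W \<inter> S)))
    = real (card S) * incidence_prob k * real (card (subspaces k))"
proof -
  have fS: "finite S" using S finite_V finite_subset by blast
  have "(\<Sum>W\<in>subspaces k. real (card (W \<inter> S)))
      = (\<Sum>W\<in>subspaces k. \<Sum>v\<in>S. if v \<in> W then 1 else 0)"
    using fS by (intro sum.cong refl) (simp add: sum.If_cases Int_commute)
  also have "\<dots> = (\<Sum>v\<in>S. \<Sum>W\<in>subspaces k. if v \<in> W then 1 else 0)" by (rule sum.swap)
  also have "\<dots> = (\<Sum>v\<in>S. real (card {W \<in> subspaces k. v \<in> W}))"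
    using finite_subspaces by (intro sum.cong refl) (simp add: sum.If_cases Int_def)
  also have "\<dots> = (\<Sum>v\<in>S. incidence_prob k * real (card (subspaces k)))"
    using S k by (intro sum.cong refl card_subspaces_containing_vector) auto
  finally show ?thesis by simp
qed

text \<open>For fixed v, at most q - 1 vectors of S lie on the line through v, and the pairs with
  these have probability at most p; all other pairs have at most p^2. The first kind is the source
  of the summand with q - 1.\<close>

lemma sum_card_Int_subspaces_squared:
  assumes S: "S \<subseteq> carrier V - {\<zero>\<^bsub>V\<^esub>}" and k: "1 \<le> k" "k \<le> dim"
  defines "\<mu> \<equiv> real (card S) * incidence_prob k"
  shows "(\<Sum>W\<in>subspaces k. (real (card (W \<inter> S)))\<^sup>2)
    \<le> ((real (card (carrier K)) - 1) * \<mu> + \<mu>\<^sup>2) * real (card (subspaces k))"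
proof -
  let ?q = "real (card (carrier K))" and ?p = "incidence_prob k" and ?a = "real (card (subspaces k))"
  have fS: "finite S" using S finite_V finite_subset by blast
  have "(\<Sum>W\<in>subspaces k. (real (card (W \<inter> S)))\<^sup>2)
      = (\<Sum>W\<in>subspaces k. \<Sum>v\<in>S. \<Sum>w\<in>S. if v \<in> W \<and> w \<in> W then 1 else 0)"
  proof (intro sum.cong refl)
    fix W
    have "(\<Sum>v\<in>S. \<Sum>w\<in>S. if v \<in> W \<and> w \<in> W then 1 else 0)
      = (\<Sum>v\<in>S. \<Sum>w\<in>S. (if v \<in> W then 1 else 0) * (if w \<in> W then 1 else (0::real)))"
      by (intro sum.cong refl) auto
    also have "\<dots> = (\<Sum>v\<in>S. if v \<in> W then 1 else 0) * (\<Sum>v\<in>S. if v \<in> W then 1 else 0)"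
      by (simp add: sum_product)
    finally show "(real (card (W \<inter> S)))\<^sup>2 = (\<Sum>v\<in>S. \<Sum>w\<in>S. if v \<in> W \<and> w \<in> W then 1 else 0)"
      using fS by (simp add: sum.If_cases Int_commute power2_eq_square)
  qed
  also have "\<dots> = (\<Sum>v\<in>S. \<Sum>w\<in>S. \<Sum>W\<in>subspaces k. if v \<in> W \<and> w \<in> W then 1 else 0)"
    by (subst sum.swap) (intro sum.cong refl sum.swap)
  also have "\<dots> = (\<Sum>v\<in>S. \<Sum>w\<in>S. real (card {W \<in> subspaces k. v \<in> W \<and> w \<in> W}))"
    using finite_subspaces by (intro sum.cong refl) (simp add: sum.If_cases Int_def)
  also have "\<dots> \<le> (\<Sum>v\<in>S. (?q - 1) * (?p * ?a) + real (card S) * (?p\<^sup>2 * ?a))"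
  proof (intro sum_mono)
    fix v assume "v \<in> S"
    then have v: "v \<in> carrier V" "v \<noteq> \<zero>\<^bsub>V\<^esub>" using S by auto
    have cs: "card (span {v}) = card (carrier K)"
      using card_span_insert[of "{}" v] v by (simp add: span_empty)
    have fs: "finite (span {v})" using finite_span_subset v by auto
    have "card (S \<inter> span {v}) \<le> card (span {v} - {\<zero>\<^bsub>V\<^esub>})"
      using S fs by (intro card_mono) auto
    also have "\<dots> = card (carrier K) - 1" using cs span_zero fs by (simp add: card_Diff_singleton)
    finally have c: "real (card (S \<inter> span {v})) \<le> ?q - 1" using card_K_ge_2 by linarith
    have p0: "0 \<le> ?p * ?a" using card_subspaces_containing_vector[OF v k] by (metis of_nat_0_le_iff)
    have "(\<Sum>w\<in>S. real (card {W \<in> subspaces k. v \<in> W \<and> w \<in> W}))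
      = (\<Sum>w\<in>S \<inter> span {v}. real (card {W \<in> subspaces k. v \<in> W \<and> w \<in> W}))
      + (\<Sum>w\<in>S - span {v}. real (card {W \<in> subspaces k. v \<in> W \<and> w \<in> W}))"
      using fS by (rule sum.Int_Diff)
    also have "\<dots> \<le> (\<Sum>w\<in>S \<inter> span {v}. ?p * ?a) + (\<Sum>w\<in>S - span {v}. ?p\<^sup>2 * ?a)"
    proof (intro add_mono sum_mono)
      fix w
      have "card {W \<in> subspaces k. v \<in> W \<and> w \<in> W} \<le> card {W \<in> subspaces k. v \<in> W}"
        using finite_subspaces by (intro card_mono) auto
      then show "real (card {W \<in> subspaces k. v \<in> W \<and> w \<in> W}) \<le> ?p * ?a"
        using card_subspaces_containing_vector[OF v k] by linarith
    next
      fix w assume "w \<in> S - span {v}"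
      then show "real (card {W \<in> subspaces k. v \<in> W \<and> w \<in> W}) \<le> ?p\<^sup>2 * ?a"
        using S v k by (intro card_subspaces_containing_two_vectors) auto
    qed
    also have "\<dots> \<le> (?q - 1) * (?p * ?a) + real (card S) * (?p\<^sup>2 * ?a)"
      unfolding sum_constant using c p0 fS
      by (intro add_mono mult_right_mono) (auto intro: card_mono)
    finally show "(\<Sum>w\<in>S. real (card {W \<in> subspaces k. v \<in> W \<and> w \<in> W}))
      \<le> (?q - 1) * (?p * ?a) + real (card S) * (?p\<^sup>2 * ?a)" .
  qed
  also have "\<dots> = ((?q - 1) * \<mu> + \<mu>\<^sup>2) * ?a"
    by (simp add: \<mu>_def power2_eq_square algebra_simps)
  finally show ?thesis .
qed

lemma incidence_prob_nonneg: "0 \<le> incidence_prob k"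
  unfolding incidence_prob_def using card_K_ge_2 by (intro divide_nonneg_nonneg) (auto intro: one_le_power)

text \<open>Chebyshev's inequality: a subspace that avoids S deviates from the mean mu by all of mu,
  while the average squared deviation is at most (q - 1) mu. The form without division also covers
  mu = 0.\<close>

lemma card_avoiding_subspaces_le:
  assumes S: "S \<subseteq> carrier V - {\<zero>\<^bsub>V\<^esub>}" and k: "1 \<le> k" "k \<le> dim"
  shows "real (card {W \<in> subspaces k. W \<inter> S = {}}) * (real (card S) * incidence_prob k)
    \<le> (real (card (carrier K)) - 1) * real (card (subspaces k))"
proof -
  define \<mu> where "\<mu> = real (card S) * incidence_prob k"
  let ?q = "real (card (carrier K))" and ?a = "real (card (subspaces k))"
    and ?G = "{W \<in> subspaces k. W \<inter> S = {}}" and ?X = "\<lambda>W. real (card (W \<inter> S))"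
  have "real (card ?G) * \<mu>\<^sup>2 = (\<Sum>W\<in>?G. (?X W - \<mu>)\<^sup>2)" by simp
  also have "\<dots> \<le> (\<Sum>W\<in>subspaces k. (?X W - \<mu>)\<^sup>2)"
    using finite_subspaces by (intro sum_mono2) auto
  also have "\<dots> = (\<Sum>W\<in>subspaces k. (?X W)\<^sup>2) - 2 * \<mu> * (\<Sum>W\<in>subspaces k. ?X W) + \<mu>\<^sup>2 * ?a"
    by (simp add: power2_diff sum.distrib sum_subtractf sum_distrib_left algebra_simps)
  also have "\<dots> \<le> ((?q - 1) * \<mu> + \<mu>\<^sup>2) * ?a - 2 * \<mu> * (\<mu> * ?a) + \<mu>\<^sup>2 * ?a"
    using sum_card_Int_subspaces_squared[OF S k] sum_card_Int_subspaces[OF S k]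
    by (simp add: \<mu>_def)
  also have "\<dots> = (?q - 1) * \<mu> * ?a" by (simp add: power2_eq_square algebra_simps)
  finally have *: "\<mu> * (real (card ?G) * \<mu>) \<le> \<mu> * ((?q - 1) * ?a)"
    by (simp add: power2_eq_square algebra_simps)
  have "\<mu> \<ge> 0" using incidence_prob_nonneg by (simp add: \<mu>_def)
  then show ?thesis
    using * card_K_ge_2 unfolding \<mu>_def[symmetric] by (cases "\<mu> = 0") auto
qed

text \<open>Markov's inequality with threshold q - 1: \<open>scale\<close> makes S a cone, so one
  hit brings a whole punctured line of hits. The gain over threshold 1 is what lets the two limits
  meet at the same exponent.\<close>

lemma card_meeting_subspaces_le:
  assumes S: "S \<subseteq> carrier V - {\<zero>\<^bsub>V\<^esub>}" and k: "1 \<le> k" "k \<le> dim"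
    and scale: "\<And>c v. c \<in> carrier K - {\<zero>\<^bsub>K\<^esub>} \<Longrightarrow> v \<in> S \<Longrightarrow> c \<odot>\<^bsub>V\<^esub> v \<in> S"
  shows "(real (card (carrier K)) - 1) * real (card {W \<in> subspaces k. W \<inter> S \<noteq> {}})
    \<le> real (card S) * incidence_prob k * real (card (subspaces k))"
proof -
  let ?q = "real (card (carrier K))" and ?B = "{W \<in> subspaces k. W \<inter> S \<noteq> {}}"
  have fS: "finite S" using S finite_V finite_subset by blast
  have "(?q - 1) * real (card ?B) = (\<Sum>W\<in>?B. ?q - 1)" by simp
  also have "\<dots> \<le> (\<Sum>W\<in>?B. real (card (W \<inter> S)))"
  proof (intro sum_mono)
    fix W assume W: "W \<in> ?B"
    then obtain v where v: "v \<in> W" "v \<in> S" by auto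
    have vV: "v \<in> carrier V" "v \<noteq> \<zero>\<^bsub>V\<^esub>" using v S by auto
    let ?f = "\<lambda>c. c \<odot>\<^bsub>V\<^esub> v" and ?C = "carrier K - {\<zero>\<^bsub>K\<^esub>}"
    have "inj_on ?f ?C"
    proof (rule inj_onI)
      fix c d assume cd: "c \<in> ?C" "d \<in> ?C" "c \<odot>\<^bsub>V\<^esub> v = d \<odot>\<^bsub>V\<^esub> v"
      show "c = d"
      proof (rule ccontr)
        assume "c \<noteq> d"
        then have e: "c \<ominus>\<^bsub>K\<^esub> d \<in> carrier K" "c \<ominus>\<^bsub>K\<^esub> d \<noteq> \<zero>\<^bsub>K\<^esub>" using cd by auto
        have "(c \<ominus>\<^bsub>K\<^esub> d) \<odot>\<^bsub>V\<^esub> v = \<zero>\<^bsub>V\<^esub>"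
          using cd vV by (simp add: a_minus_def smult_l_distr smult_l_minus M.r_neg)
        from mult_inverse[OF e(1) vV(1) this e(2)] show False using e vV by simp
      qed
    qed
    then have "card ?C = card (?f ` ?C)" by (simp add: card_image)
    also have "\<dots> \<le> card (W \<inter> S)"
    proof (rule card_mono)
      have "LinearCombinations.submodule K W V"
        using W by (auto simp: subspaces_def VectorSpace.subspace_def)
      then show "?f ` ?C \<subseteq> W \<inter> S"
        using scale v submodule.smult_closed by fastforce
    qed (use fS in simp)
    finally show "?q - 1 \<le> real (card (W \<inter> S))"
      using card_K_ge_2 finite_K by (simp add: card_Diff_singleton)
  qed
  also have "\<dots> \<le> (\<Sum>W\<in>subspaces k. real (card (W \<inter> S)))"
    using finite_subspaces by (intro sum_mono2) auto
  finally show ?thesis using sum_card_Int_subspaces[OF S k] by simp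
qed

section \<open>Size of the incidence probability\<close>

lemma incidence_prob_upper:
  assumes "1 \<le> k" "k \<le> dim"
  shows "incidence_prob k \<le> real (card (carrier K)) ^ k / real (card (carrier K)) ^ dim"
proof -
  let ?q = "real (card (carrier K))"
  have q: "?q \<ge> 2" using card_K_ge_2 by simp
  have "?q ^ dim > 1" "?q ^ k \<le> ?q ^ dim"
    using q assms by (auto intro!: one_less_power power_increasing)
  then have "0 < ?q ^ dim - 1" "0 < ?q ^ dim" and "(?q ^ k - 1) * ?q ^ dim \<le> ?q ^ k * (?q ^ dim - 1)"
    by (linarith, linarith, simp add: algebra_simps)
  then show ?thesis unfolding incidence_prob_def
    by (simp only: pos_divide_le_eq pos_le_divide_eq times_divide_eq_left)
qed

text \<open>From q^k >= 2 follows q^k - 1 >= q^k / 2, the origin of the constant 2.\<close>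

lemma incidence_prob_lower:
  assumes "1 \<le> k" "k \<le> dim"
  shows "real (card (carrier K)) ^ k / real (card (carrier K)) ^ dim \<le> 2 * incidence_prob k"
proof -
  define Q where "Q = real (card (carrier K))"
  have q: "Q \<ge> 2" using card_K_ge_2 by (simp add: Q_def)
  have *: "Q ^ dim > 1" using q assms by (auto intro!: one_less_power)
  have "Q ^ k \<ge> Q" using q assms power_increasing[of 1 k Q] by simp
  then have "2 \<le> Q ^ k" by (rule order_trans[OF q])
  then have "Q ^ k \<le> 2 * (Q ^ k - 1)" by argo
  then have "Q ^ k / Q ^ dim \<le> 2 * (Q ^ k - 1) / (Q ^ dim - 1)"
    using * q by (intro frac_le) auto
  then show ?thesis unfolding incidence_prob_def Q_def by simp
qed

lemma subspaces_nonempty: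
  assumes "k \<le> dim" shows "card (subspaces k) > 0"
proof -
  have "(\<Prod>i = 0..<k. card (carrier V) - card (carrier K) ^ i) > 0"
    unfolding card_carrier using assms card_K_ge_2
    by (intro prod_pos) (auto intro!: power_strict_increasing)
  moreover have "card (subspaces k) * (\<Prod>i = 0..<k. card (carrier K) ^ k - card (carrier K) ^ i)
      = (\<Prod>i = 0..<k. card (carrier V) - card (carrier K) ^ i)"
    using card_subspaces_containing[of "[]" k] by simp
  ultimately show ?thesis by (metis gr0I mult_0 less_irrefl)
qed

end

section \<open>Schur complements of alternating matrices\<close>

locale finite_field_matrices = field R for R :: "'a ring" (structure) +
  fixes n :: nat
  assumes finite_carrier: "finite (carrier R)"
begin

abbreviation col_vectors :: "('a, nat \<Rightarrow> 'a) module" where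
  "col_vectors \<equiv> func_space {..<n}"

definition col_space :: "(nat \<times> nat \<Rightarrow> 'a) \<Rightarrow> (nat \<Rightarrow> 'a) set" where
  "col_space M = LinearCombinations.module.span R col_vectors (mat_column n M ` {..<n})"

text \<open>Matrices supported on I x I, but still of size n: elimination shrinks I and never has to
  reindex.\<close>

definition alt_on :: "nat set \<Rightarrow> (nat \<times> nat \<Rightarrow> 'a) set" where
  "alt_on I = {M \<in> alt_mats R n. \<forall>k<n. \<forall>l<n. k \<notin> I \<or> l \<notin> I \<longrightarrow> M (k, l) = \<zero>}"

text \<open>M plus c times the wedge u v^T - v u^T, an alternating update of rank at most 2.
  Elimination and its inverse are both of this form.\<close>

definition add_wedge ::
  "'a \<Rightarrow> (nat \<Rightarrow> 'a) \<Rightarrow> (nat \<Rightarrow> 'a) \<Rightarrow> (nat \<times> nat \<Rightarrow> 'a) \<Rightarrow> nat \<times> nat \<Rightarrow> 'a" where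
  "add_wedge c u v M =
     (\<lambda>(k, l)\<in>{..<n} \<times> {..<n}. M (k, l) \<oplus> c \<otimes> (u k \<otimes> v l \<ominus> v k \<otimes> u l))"

text \<open>Schur complement of the block on rows and columns i, j. That block is a multiple of the
  standard 2 x 2 symplectic form, so inverting it leaves a single wedge of the two pivot
  rows.\<close>

definition schur :: "nat \<Rightarrow> nat \<Rightarrow> (nat \<times> nat \<Rightarrow> 'a) \<Rightarrow> nat \<times> nat \<Rightarrow> 'a" where
  "schur i j M = add_wedge (\<ominus> (inv M (i, j))) (\<lambda>k. M (i, k)) (\<lambda>k. M (j, k)) M"

lemma vectorspace_func_space: "vectorspace R (func_space S)"
proof -
  have "field R" ..
  moreover have "Module.module R (func_space S)" by (rule func_space_is_module)
  ultimately show ?thesis by (simp add: vectorspace_def)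
qed

lemma finite_vectorspace_func_space:
  assumes "finite S" shows "finite_vectorspace R (func_space S)"
proof -
  interpret vectorspace R "func_space S" by (rule vectorspace_func_space)
  show ?thesis
    by unfold_locales (use assms finite_carrier in \<open>auto simp: func_space_def intro: finite_PiE\<close>)
qed

sublocale cols: finite_vectorspace R col_vectors
  by (rule finite_vectorspace_func_space) simp

lemma alt_mats_PiE: "M \<in> alt_mats R n \<Longrightarrow> M \<in> ({..<n} \<times> {..<n}) \<rightarrow>\<^sub>E carrier R"
  unfolding alt_mats_def mat_space_def func_space_def by simp

lemma alt_entry [simp, intro]: "M \<in> alt_mats R n \<Longrightarrow> k < n \<Longrightarrow> l < n \<Longrightarrow> M (k, l) \<in> carrier R"
  using alt_mats_PiE by fastforce

lemma mat_column_in: "M \<in> alt_mats R n \<Longrightarrow> j < n \<Longrightarrow> mat_column n M j \<in> carrier col_vectors"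
  by (auto simp: mat_column_def func_space_def)

lemma card_col_space:
  assumes "M \<in> alt_mats R n"
  shows "card (col_space M) = card (carrier R) ^ mat_rank R n M"
proof -
  have "VectorSpace.subspace R (col_space M) col_vectors"
    unfolding col_space_def using mat_column_in[OF assms] by (intro cols.span_is_subspace) auto
  from cols.card_subspace[OF this] show ?thesis
    by (simp add: mat_rank_def col_space_def Let_def)
qed

text \<open>Transfers rank conditions to sizes of column spaces, where a Schur step is a factor
  q^2.\<close>

lemma mat_rank_less_iff:
  assumes "M \<in> alt_mats R n"
  shows "mat_rank R n M < d \<longleftrightarrow> card (col_space M) < card (carrier R) ^ d"
  using card_col_space[OF assms] cols.card_K_ge_2 by simp

lemma alt_swap: "M \<in> alt_mats R n \<Longrightarrow> k < n \<Longrightarrow> l < n \<Longrightarrow> M (k, l) = \<ominus> M (l, k)"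
  unfolding alt_mats_def by blast

lemma alt_diag [simp]: "M \<in> alt_mats R n \<Longrightarrow> k < n \<Longrightarrow> M (k, k) = \<zero>"
  unfolding alt_mats_def by blast

lemma alt_matsI:
  assumes "M \<in> extensional ({..<n} \<times> {..<n})"
    and "\<And>k l. k < n \<Longrightarrow> l < n \<Longrightarrow> M (k, l) \<in> carrier R"
    and "\<And>k l. k < n \<Longrightarrow> l < n \<Longrightarrow> M (k, l) = \<ominus> M (l, k)"
    and "\<And>k. k < n \<Longrightarrow> M (k, k) = \<zero>"
  shows "M \<in> alt_mats R n"
proof -
  have "M \<in> carrier (mat_space R n)"
    unfolding mat_space_def func_space_def using assms(1,2) by (auto simp: PiE_def)
  then show ?thesis unfolding alt_mats_def using assms(3,4) by blast
qed

lemma alt_ext: "M \<in> alt_mats R n \<Longrightarrow> M \<in> extensional ({..<n} \<times> {..<n})"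
  using alt_mats_PiE by (auto simp: PiE_def)

lemma alt_eqI:
  assumes "M \<in> alt_mats R n" "N \<in> alt_mats R n"
    and "\<And>k l. k < n \<Longrightarrow> l < n \<Longrightarrow> M (k, l) = N (k, l)"
  shows "M = N"
  by (rule extensionalityI[OF alt_ext alt_ext]) (use assms in auto)

lemma alt_onD:
  assumes "M \<in> alt_on I"
  shows "M \<in> alt_mats R n" "\<And>k l. k < n \<Longrightarrow> l < n \<Longrightarrow> k \<notin> I \<or> l \<notin> I \<Longrightarrow> M (k, l) = \<zero>"
  using assms by (auto simp: alt_on_def)

lemma finite_alt_mats: "finite (alt_mats R n)"
proof (rule finite_subset)
  show "alt_mats R n \<subseteq> ({..<n} \<times> {..<n}) \<rightarrow>\<^sub>E carrier R" using alt_mats_PiE by blast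
  show "finite (({..<n} \<times> {..<n}) \<rightarrow>\<^sub>E carrier R)" by (simp add: finite_PiE finite_carrier)
qed

lemma finite_alt_on: "finite (alt_on I)"
  by (rule finite_subset[OF _ finite_alt_mats]) (auto simp: alt_on_def)

lemma add_wedge_apply:
  "k < n \<Longrightarrow> l < n \<Longrightarrow> add_wedge c u v M (k, l) = M (k, l) \<oplus> c \<otimes> (u k \<otimes> v l \<ominus> v k \<otimes> u l)"
  by (simp add: add_wedge_def)

lemma add_wedge_alt_on:
  assumes M: "M \<in> alt_on I" and c: "c \<in> carrier R"
    and u: "\<And>k. k < n \<Longrightarrow> u k \<in> carrier R" "\<And>k. k < n \<Longrightarrow> k \<notin> I \<Longrightarrow> u k = \<zero>"
    and v: "\<And>k. k < n \<Longrightarrow> v k \<in> carrier R" "\<And>k. k < n \<Longrightarrow> k \<notin> I \<Longrightarrow> v k = \<zero>"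
  shows "add_wedge c u v M \<in> alt_on I"
proof -
  note Ma = alt_onD(1)[OF M]
  have "add_wedge c u v M \<in> alt_mats R n"
  proof (rule alt_matsI)
    fix k l assume kl: "k < n" "l < n"
    show "add_wedge c u v M (k, l) \<in> carrier R"
      using kl Ma c u v by (simp add: add_wedge_apply)
    show "add_wedge c u v M (k, l) = \<ominus> add_wedge c u v M (l, k)"
      unfolding add_wedge_apply[OF kl] add_wedge_apply[OF kl(2,1)] alt_swap[OF Ma kl]
      using alt_entry[OF Ma kl(2,1)] c u(1)[OF kl(1)] u(1)[OF kl(2)] v(1)[OF kl(1)] v(1)[OF kl(2)]
      by algebra
  next
    fix k assume k: "k < n"
    show "add_wedge c u v M (k, k) = \<zero>"
      unfolding add_wedge_apply[OF k k] alt_diag[OF Ma k]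
      using c u(1)[OF k] v(1)[OF k] by algebra
  qed (simp add: add_wedge_def)
  moreover have "add_wedge c u v M (k, l) = \<zero>" if "k < n" "l < n" "k \<notin> I \<or> l \<notin> I" for k l
    using that alt_onD(2)[OF M that] u v c by (auto simp: add_wedge_apply a_minus_def)
  ultimately show ?thesis by (simp add: alt_on_def)
qed

context
  fixes i j :: nat
  assumes ij: "i < n" "j < n"
begin

lemma schur_apply:
  assumes "k < n" "l < n"
  shows "schur i j M (k, l)
    = M (k, l) \<oplus> (\<ominus> (inv M (i, j))) \<otimes> (M (i, k) \<otimes> M (j, l) \<ominus> M (j, k) \<otimes> M (i, l))"
  using assms by (simp add: schur_def add_wedge_apply)

text \<open>The wedge is scaled so that it reproduces rows i and j of M, and subtracting it cancels
  both; the columns follow by alternation. The rows of M vanish outside I, so the support does not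
  grow.\<close>

lemma schur_alt_on:
  assumes M: "M \<in> alt_on I" and nz: "M (i, j) \<noteq> \<zero>"
  shows "schur i j M \<in> alt_on (I - {i, j})"
proof -
  note Ma = alt_onD(1)[OF M]
  have inv: "inv M (i, j) \<in> carrier R" "inv M (i, j) \<otimes> M (i, j) = \<one>"
    using nz Ma ij by (auto simp: field_Units)
  have S: "schur i j M \<in> alt_on I"
    unfolding schur_def by (rule add_wedge_alt_on[OF M]) (use inv ij Ma alt_onD(2)[OF M] in auto)
  note Sa = alt_onD(1)[OF S]
  have ji: "M (j, i) = \<ominus> M (i, j)" using alt_swap[OF Ma ij(2,1)] .
  have i0: "schur i j M (i, l) = \<zero>" if l: "l < n" for l
  proof -
    have "schur i j M (i, l) = M (i, l) \<ominus> (inv M (i, j) \<otimes> M (i, j)) \<otimes> M (i, l)"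
      unfolding schur_apply[OF ij(1) l] alt_diag[OF Ma ij(1)] ji
      using inv(1) alt_entry[OF Ma ij] alt_entry[OF Ma ij(1) l] alt_entry[OF Ma ij(2) l] by algebra
    then show ?thesis using inv(2) alt_entry[OF Ma ij(1) l] by simp
  qed
  have j0: "schur i j M (j, l) = \<zero>" if l: "l < n" for l
  proof -
    have "schur i j M (j, l) = M (j, l) \<ominus> (inv M (i, j) \<otimes> M (i, j)) \<otimes> M (j, l)"
      unfolding schur_apply[OF ij(2) l] alt_diag[OF Ma ij(2)]
      using inv(1) alt_entry[OF Ma ij] alt_entry[OF Ma ij(1) l] alt_entry[OF Ma ij(2) l] by algebra
    then show ?thesis using inv(2) alt_entry[OF Ma ij(2) l] by simp
  qed
  have "schur i j M (k, l) = \<zero>" if "k < n" "l < n" "k \<notin> I - {i, j} \<or> l \<notin> I - {i, j}" for k l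
    using that i0 j0 alt_onD(2)[OF S that(1,2)] alt_swap[OF Sa that(1,2)] by auto
  then show ?thesis using Sa by (simp add: alt_on_def)
qed

text \<open>Each column of the complement differs from the corresponding column of M by a
  combination of columns i and j of M. Adjoining these two to the reduced columns therefore gives
  the old column space, and each adjunction multiplies the size by q.\<close>

lemma card_col_space_schur:
  assumes Ma: "M \<in> alt_mats R n" and nz: "M (i, j) \<noteq> \<zero>"
  shows "card (col_space M) = card (carrier R) ^ 2 * card (col_space (schur i j M))"
proof -
  let ?a = "inv M (i, j)" and ?N = "schur i j M"
  let ?c = "mat_column n M" and ?c' = "mat_column n ?N"
  let ?C = "?c ` {..<n}" and ?C' = "?c' ` {..<n}"
  have inv: "?a \<in> carrier R" using nz Ma ij by auto
  have "M \<in> alt_on UNIV" using Ma by (simp add: alt_on_def)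
  from schur_alt_on[OF this nz] have N: "?N \<in> alt_on (UNIV - {i, j})" .
  note Na = alt_onD(1)[OF N]
  have cin: "?c l \<in> carrier col_vectors" "?c' l \<in> carrier col_vectors" if "l < n" for l
    using that mat_column_in Ma Na by auto
  have Cin: "?C \<subseteq> carrier col_vectors" "?C' \<subseteq> carrier col_vectors" using cin by auto
  have c'_eq: "?c' l = ?c l \<oplus>\<^bsub>col_vectors\<^esub> ((?a \<otimes> M (j, l)) \<odot>\<^bsub>col_vectors\<^esub> ?c i
      \<oplus>\<^bsub>col_vectors\<^esub> (\<ominus> (?a \<otimes> M (i, l))) \<odot>\<^bsub>col_vectors\<^esub> ?c j)" if l: "l < n" for l
  proof
    fix k
    show "?c' l k = (?c l \<oplus>\<^bsub>col_vectors\<^esub> ((?a \<otimes> M (j, l)) \<odot>\<^bsub>col_vectors\<^esub> ?c i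
      \<oplus>\<^bsub>col_vectors\<^esub> (\<ominus> (?a \<otimes> M (i, l))) \<odot>\<^bsub>col_vectors\<^esub> ?c j)) k"
    proof (cases "k < n")
      case k: True
      have "M (k, l) \<oplus> (\<ominus> ?a) \<otimes> (M (i, k) \<otimes> M (j, l) \<ominus> M (j, k) \<otimes> M (i, l))
        = M (k, l) \<oplus> ((?a \<otimes> M (j, l)) \<otimes> M (k, i) \<oplus> (\<ominus> (?a \<otimes> M (i, l))) \<otimes> M (k, j))"
        unfolding alt_swap[OF Ma ij(1) k] alt_swap[OF Ma ij(2) k]
        using inv alt_entry[OF Ma k l] alt_entry[OF Ma k ij(1)] alt_entry[OF Ma k ij(2)]
          alt_entry[OF Ma ij(1) l] alt_entry[OF Ma ij(2) l] by algebra
      then show ?thesis using k l by (simp add: mat_column_def func_space_def schur_apply)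
    qed (simp add: mat_column_def func_space_def)
  qed
  let ?d = "\<lambda>l. (?a \<otimes> M (j, l)) \<odot>\<^bsub>col_vectors\<^esub> ?c i
      \<oplus>\<^bsub>col_vectors\<^esub> (\<ominus> (?a \<otimes> M (i, l))) \<odot>\<^bsub>col_vectors\<^esub> ?c j"
  let ?G = "insert (?c i) (insert (?c j) ?C')"
  have Gin: "?G \<subseteq> carrier col_vectors" using Cin cin ij by auto
  have d_in: "?d l \<in> cols.span T" if l: "l < n" and T: "T \<subseteq> carrier col_vectors" "?c i \<in> T" "?c j \<in> T" for l T
  proof -
    have sm: "LinearCombinations.submodule R (cols.span T) col_vectors"
      by (rule cols.span_is_submodule[OF T(1)])
    have "?c i \<in> cols.span T" "?c j \<in> cols.span T" using cols.span_mem T by auto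
    moreover have "?a \<otimes> M (j, l) \<in> carrier R" "\<ominus> (?a \<otimes> M (i, l)) \<in> carrier R"
      using inv Ma ij l by auto
    ultimately show ?thesis
      using submodule.smult_closed[OF sm] submodule.m_closed[OF sm] by blast
  qed
  have "cols.span ?C = cols.span ?G"
  proof
    have "?c l \<in> cols.span ?G" if l: "l < n" for l
    proof -
      have d: "?d l \<in> cols.span ?G" by (rule d_in[OF l Gin]) auto
      have "?c' l \<in> cols.span ?G" using cols.span_mem[OF Gin] l by auto
      then have "?d l \<oplus>\<^bsub>col_vectors\<^esub> ?c l \<in> cols.span ?G"
        using c'_eq[OF l] cols.span_closed[OF Gin d] cin(1)[OF l] cols.M.a_comm by metis
      then show ?thesis using cols.span_add[OF Gin d cin(1)[OF l]] by simp
    qed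
    then show "cols.span ?C \<subseteq> cols.span ?G"
      by (intro cols.span_is_subset cols.span_is_submodule[OF Gin]) auto
    have "?c' l \<in> cols.span ?C" if l: "l < n" for l
    proof -
      have "?d l \<in> cols.span ?C" by (rule d_in[OF l Cin(1)]) (use ij in auto)
      moreover have "?c l \<in> cols.span ?C" using cols.span_mem[OF Cin(1)] l by auto
      ultimately show ?thesis using c'_eq[OF l] cols.span_add1[OF Cin(1)] by metis
    qed
    moreover have "?c i \<in> cols.span ?C" "?c j \<in> cols.span ?C"
      using cols.span_mem[OF Cin(1)] ij by auto
    ultimately show "cols.span ?G \<subseteq> cols.span ?C"
      by (intro cols.span_is_subset cols.span_is_submodule[OF Cin(1)]) auto
  qed
  moreover have vanish: "LinearCombinations.submodule R {x \<in> carrier col_vectors. x h = \<zero>} col_vectors"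
    if "h < n" for h
    by (rule submodule.intro) (use that cols.module_axioms in \<open>auto simp: func_space_def\<close>)
  \<comment> \<open>The reduced columns vanish at coordinate i, where column j has the entry
    \<open>M (i, j)\<close>.\<close>
  have "?c j \<notin> cols.span ?C'"
  proof
    assume "?c j \<in> cols.span ?C'"
    moreover have "cols.span ?C' \<subseteq> {x \<in> carrier col_vectors. x i = \<zero>}"
      using Cin(2) alt_onD(2)[OF N] ij
      by (intro cols.span_is_subset vanish) (auto simp: mat_column_def)
    ultimately show False using nz ij by (auto simp: mat_column_def)
  qed
  \<comment> \<open>Here the coordinate is j: column j vanishes there because the diagonal is zero,
    and column i has the nonzero entry \<open>M (j, i)\<close>.\<close>
  moreover have "?c i \<notin> cols.span (insert (?c j) ?C')"
  proof
    assume "?c i \<in> cols.span (insert (?c j) ?C')"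
    moreover have "cols.span (insert (?c j) ?C') \<subseteq> {x \<in> carrier col_vectors. x j = \<zero>}"
      using Cin(2) cin ij alt_onD(2)[OF N] Ma
      by (intro cols.span_is_subset vanish) (auto simp: mat_column_def)
    ultimately have "M (j, i) = \<zero>" using ij by (auto simp: mat_column_def)
    then show False using alt_swap[OF Ma ij] nz by simp
  qed
  ultimately show ?thesis
    using cols.card_span_insert[of ?C' "?c j"] cols.card_span_insert[of "insert (?c j) ?C'" "?c i"]
      Cin(2) cin ij by (simp add: col_space_def power2_eq_square)
qed

end

lemma card_col_space_pos:
  assumes "M \<in> alt_mats R n" shows "0 < card (col_space M)"
  using card_col_space[OF assms] cols.card_K_ge_2 by simp

end

section \<open>Counting alternating matrices of low rank\<close>

text \<open>The dimension of the variety of alternating matrices of size \<open>2 * r + s\<close> and rank at most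
  \<open>2 * r\<close>.\<close>

definition low_rank_dim :: "nat \<Rightarrow> nat \<Rightarrow> nat" where
  "low_rank_dim r s = (\<Sum>i<r. 1 + 2 * (2 * i + s))"

context finite_field_matrices
begin

text \<open>Rank at most 2 r, written as rank below 2 r + 2 and in terms of size: passing to the
  Schur complement divides both sides by q^2 and lowers r by one.\<close>

definition low_rank :: "nat set \<Rightarrow> nat \<Rightarrow> (nat \<times> nat \<Rightarrow> 'a) set" where
  "low_rank I r = {M \<in> alt_on I. card (col_space M) < card (carrier R) ^ (2 * r + 2)}"

definition zero_mat :: "nat \<times> nat \<Rightarrow> 'a" where
  "zero_mat = (\<lambda>_\<in>{..<n} \<times> {..<n}. \<zero>)"

lemma zero_mat_apply: "k < n \<Longrightarrow> l < n \<Longrightarrow> zero_mat (k, l) = \<zero>"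
  by (simp add: zero_mat_def)

lemma zero_mat_alt_on: "zero_mat \<in> alt_on I"
  unfolding alt_on_def by (auto intro!: alt_matsI simp: zero_mat_apply) (simp add: zero_mat_def)

lemma nonzero_entry:
  assumes "M \<in> alt_on I" "M \<noteq> zero_mat"
  obtains i j where "i \<in> I" "j \<in> I" "i < n" "j < n" "i \<noteq> j" "M (i, j) \<noteq> \<zero>"
proof -
  have "\<exists>i<n. \<exists>j<n. M (i, j) \<noteq> \<zero>"
  proof (rule ccontr)
    assume "\<not> ?thesis"
    then have "M = zero_mat"
      using alt_onD(1)[OF assms(1)] alt_onD(1)[OF zero_mat_alt_on]
      by (intro alt_eqI) (auto simp: zero_mat_apply)
    then show False using assms by simp
  qed
  then obtain i j where "i < n" "j < n" "M (i, j) \<noteq> \<zero>" by blast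
  moreover from this have "i \<in> I" "j \<in> I" using alt_onD(2)[OF assms(1)] by blast+
  moreover have "i \<noteq> j" using calculation alt_diag[OF alt_onD(1)[OF assms(1)]] by auto
  ultimately show ?thesis using that by blast
qed

text \<open>A nonzero alternating matrix has a pivot, and one elimination step shows that its column
  space has at least q^2 elements. This excludes rank 1, which is where the evenness of alternating
  ranks enters.\<close>

lemma low_rank_0: "low_rank I 0 = {zero_mat}"
proof
  show "low_rank I 0 \<subseteq> {zero_mat}"
  proof
    fix M assume M: "M \<in> low_rank I 0"
    then have MI: "M \<in> alt_on I" by (simp add: low_rank_def)
    show "M \<in> {zero_mat}"
    proof (rule ccontr)
      assume "M \<notin> {zero_mat}"
      then obtain i j where ij: "i < n" "j < n" "i \<in> I" "j \<in> I" "M (i, j) \<noteq> \<zero>"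
        using nonzero_entry[OF MI] by blast
      have "schur i j M \<in> alt_mats R n" using schur_alt_on[OF ij(1,2) MI ij(5)] alt_onD by blast
      then have "card (col_space (schur i j M)) \<ge> 1" using card_col_space_pos by fastforce
      then have "card (carrier R) ^ 2 \<le> card (col_space M)"
        using card_col_space_schur[OF ij(1,2) alt_onD(1)[OF MI] ij(5)] by simp
      then show False using M by (simp add: low_rank_def power2_eq_square)
    qed
  qed
  have "mat_column n zero_mat ` {..<n} \<subseteq> {\<zero>\<^bsub>col_vectors\<^esub>}"
    by (auto simp: mat_column_def func_space_def zero_mat_apply)
  then have "col_space zero_mat \<subseteq> {\<zero>\<^bsub>col_vectors\<^esub>}"
    unfolding col_space_def
    by (rule cols.span_is_subset) (rule submodule.intro, use cols.module_axioms in auto)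
  from card_mono[OF _ this] have "card (col_space zero_mat) \<le> 1" by simp
  moreover have "1 < card (carrier R) ^ 2" using cols.card_K_ge_2 by (intro one_less_power) auto
  ultimately show "{zero_mat} \<subseteq> low_rank I 0"
    using zero_mat_alt_on by (simp add: low_rank_def power2_eq_square)
qed

lemma zero_mat_low_rank: "zero_mat \<in> low_rank I r"
proof -
  have "card (carrier R) ^ 2 \<le> card (carrier R) ^ (2 * r + 2)"
    using cols.card_K_ge_2 by (intro power_increasing) auto
  moreover have "card (col_space zero_mat) < card (carrier R) ^ 2"
    using low_rank_0[of UNIV] by (auto simp: low_rank_def power2_eq_square)
  ultimately have "card (col_space zero_mat) < card (carrier R) ^ (2 * r + 2)" by (rule less_le_trans[rotated])
  then show ?thesis using zero_mat_alt_on unfolding low_rank_def by blast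
qed

lemma finite_low_rank: "finite (low_rank I r)"
  using finite_alt_on by (simp add: low_rank_def)

text \<open>A pivot row rebuilt from its free entries u on J: the entry at the other pivot index j
  is forced to be a, and the one at its own index falls under the default zero.\<close>

definition pivot_row :: "nat set \<Rightarrow> nat \<Rightarrow> 'a \<Rightarrow> (nat \<Rightarrow> 'a) \<Rightarrow> nat \<Rightarrow> 'a" where
  "pivot_row J j a u k = (if k \<in> J then u k else if k = j then a else \<zero>)"

text \<open>Elimination is invertible: the pivot, the remaining entries of the two pivot rows and
  the Schur complement are independent parameters, one for each factor. The rank condition passes
  through because the size of the column space changes by exactly q^2.\<close>

lemma card_low_rank_pivot:
  assumes I: "I \<subseteq> {..<n}" and ij: "i \<in> I" "j \<in> I" "i \<noteq> j"
  shows "card {M \<in> low_rank I (Suc r). M (i, j) \<noteq> \<zero>}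
    = (card (carrier R) - 1) * card (carrier R) ^ (2 * (card I - 2)) * card (low_rank (I - {i, j}) r)"
proof -
  let ?J = "I - {i, j}"
  let ?X = "{M \<in> low_rank I (Suc r). M (i, j) \<noteq> \<zero>}"
  let ?Y = "(carrier R - {\<zero>}) \<times> (?J \<rightarrow>\<^sub>E carrier R) \<times> (?J \<rightarrow>\<^sub>E carrier R) \<times> low_rank ?J r"
  define f where "f M = (M (i, j), restrict (\<lambda>k. M (i, k)) ?J, restrict (\<lambda>k. M (j, k)) ?J, schur i j M)"
    for M :: "nat \<times> nat \<Rightarrow> 'a"
  \<comment> \<open>Adding the wedge back undoes \<open>schur\<close>. Alternation forces the entry
    of row j at index i to be the negative of a.\<close>
  define g where "g = (\<lambda>(a, u, v, N). add_wedge (inv a) (pivot_row ?J j a u) (pivot_row ?J i (\<ominus> a) v) N)"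
  have n: "i < n" "j < n" using I ij by auto
  have fin: "finite I" using I finite_subset by blast
  have f_in: "f M \<in> ?Y" if "M \<in> ?X" for M
  proof -
    have M: "M \<in> alt_on I" "M (i, j) \<noteq> \<zero>" using that by (auto simp: low_rank_def)
    note Ma = alt_onD(1)[OF M(1)]
    have "card (col_space M) = card (carrier R) ^ 2 * card (col_space (schur i j M))"
      by (rule card_col_space_schur[OF n Ma M(2)])
    moreover have "card (col_space M) < card (carrier R) ^ 2 * card (carrier R) ^ (2 * r + 2)"
      using that by (simp add: low_rank_def power2_eq_square mult.assoc)
    ultimately have "schur i j M \<in> low_rank ?J r"
      using schur_alt_on[OF n M] by (simp add: low_rank_def)
    then show ?thesis using M Ma I n by (auto simp: f_def)
  qed
  have g_props: "g y \<in> ?X \<and> f (g y) = y" if "y \<in> ?Y" for y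
  proof -
    obtain a u v N where y: "y = (a, u, v, N)" by (cases y)
    have a: "a \<in> carrier R" "a \<noteq> \<zero>" and u: "u \<in> ?J \<rightarrow>\<^sub>E carrier R" and v: "v \<in> ?J \<rightarrow>\<^sub>E carrier R"
      and N: "N \<in> alt_on ?J" and Nl: "card (col_space N) < card (carrier R) ^ (2 * r + 2)"
      using that y by (auto simp: low_rank_def)
    define u' where "u' = pivot_row ?J j a u"
    define v' where "v' = pivot_row ?J i (\<ominus> a) v"
    define M where "M = add_wedge (inv a) u' v' N"
    have inva: "inv a \<in> carrier R" "inv a \<otimes> a = \<one>" using a by (auto simp: field_Units)
    have uc: "u' k \<in> carrier R" "v' k \<in> carrier R" for k
      using u v a by (auto simp: u'_def v'_def pivot_row_def)
    have u0: "k \<notin> I \<Longrightarrow> u' k = \<zero>" "k \<notin> I \<Longrightarrow> v' k = \<zero>" for k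
      using ij by (auto simp: u'_def v'_def pivot_row_def)
    have uij: "u' i = \<zero>" "u' j = a" "v' i = \<ominus> a" "v' j = \<zero>"
      using ij by (auto simp: u'_def v'_def pivot_row_def)
    note Na = alt_onD(1)[OF N]
    have NI: "N \<in> alt_on I" using N by (auto simp: alt_on_def)
    have MI: "M \<in> alt_on I" unfolding M_def
      by (rule add_wedge_alt_on[OF NI]) (use inva uc u0 in auto)
    note Ma = alt_onD(1)[OF MI]
    \<comment> \<open>Row i of N is zero, so the wedge alone supplies this row; the same holds for
      row j.\<close>
    have rowi: "M (i, k) = u' k" if k: "k < n" for k
    proof -
      have "M (i, k) = (inv a \<otimes> a) \<otimes> u' k"
        unfolding M_def add_wedge_apply[OF n(1) k] uij
        using alt_onD(2)[OF N n(1) k] inva(1) a(1) uc[of k] by (simp, algebra)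
      then show ?thesis using inva(2) uc by simp
    qed
    have rowj: "M (j, k) = v' k" if k: "k < n" for k
    proof -
      have "M (j, k) = (inv a \<otimes> a) \<otimes> v' k"
        unfolding M_def add_wedge_apply[OF n(2) k] uij
        using alt_onD(2)[OF N n(2) k] inva(1) a(1) uc[of k] by (simp, algebra)
      then show ?thesis using inva(2) uc by simp
    qed
    have Mij: "M (i, j) = a" using rowi[OF n(2)] uij by simp
    \<comment> \<open>Rows i and j of M are now known to be \<open>u'\<close> and \<open>v'\<close>,
      so \<open>schur\<close> subtracts exactly the wedge that was added.\<close>
    have schurM: "schur i j M = N"
    proof (rule alt_eqI)
      show "schur i j M \<in> alt_mats R n" using schur_alt_on[OF n MI] Mij a alt_onD(1) by blast
      show "N \<in> alt_mats R n" by (rule Na)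
      fix k l assume kl: "k < n" "l < n"
      show "schur i j M (k, l) = N (k, l)"
        unfolding schur_apply[OF n kl] Mij rowi[OF kl(1)] rowi[OF kl(2)] rowj[OF kl(1)] rowj[OF kl(2)]
        unfolding M_def add_wedge_apply[OF kl]
        using inva(1) uc[of k] uc[of l] alt_entry[OF Na kl] by algebra
    qed
    have "card (col_space M) = card (carrier R) ^ 2 * card (col_space N)"
      using card_col_space_schur[OF n Ma] Mij a schurM by simp
    then have "card (col_space M) < card (carrier R) ^ 2 * card (carrier R) ^ (2 * r + 2)"
      using Nl cols.card_K_ge_2 by simp
    then have "M \<in> ?X" using MI Mij a by (simp add: low_rank_def power2_eq_square mult.assoc)
    moreover have "f M = y"
    proof -
      have "restrict (\<lambda>k. M (i, k)) ?J = u"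
        using rowi I u by (intro extensionalityI[of _ ?J]) (auto simp: u'_def pivot_row_def PiE_def)
      moreover have "restrict (\<lambda>k. M (j, k)) ?J = v"
        using rowj I v by (intro extensionalityI[of _ ?J]) (auto simp: v'_def pivot_row_def PiE_def)
      ultimately show ?thesis using Mij schurM by (simp add: f_def y)
    qed
    moreover have "g y = M" by (simp add: g_def y M_def u'_def v'_def)
    ultimately show ?thesis by simp
  qed
  have gf: "g (f M) = M" if "M \<in> ?X" for M
  proof -
    have M: "M \<in> alt_on I" "M (i, j) \<noteq> \<zero>" using that by (auto simp: low_rank_def)
    note Ma = alt_onD(1)[OF M(1)]
    have inva: "inv M (i, j) \<in> carrier R" using M(2) Ma n by auto
    have gfM: "g (f M) \<in> alt_on I" using g_props[OF f_in[OF that]] by (auto simp: low_rank_def)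
    have u: "pivot_row ?J j (M (i, j)) (restrict (\<lambda>k. M (i, k)) ?J) k = M (i, k)" if "k < n" for k
      using that n Ma alt_onD(2)[OF M(1) n(1) that] by (auto simp: pivot_row_def)
    have v: "pivot_row ?J i (\<ominus> M (i, j)) (restrict (\<lambda>k. M (j, k)) ?J) k = M (j, k)" if "k < n" for k
      using that n Ma alt_onD(2)[OF M(1) n(2) that] alt_swap[OF Ma n(2,1)]
      by (auto simp: pivot_row_def)
    show ?thesis
    proof (rule alt_eqI)
      show "g (f M) \<in> alt_mats R n" using alt_onD(1)[OF gfM] .
      show "M \<in> alt_mats R n" by (rule Ma)
      fix k l assume kl: "k < n" "l < n"
      show "g (f M) (k, l) = M (k, l)"
        unfolding f_def g_def prod.case add_wedge_apply[OF kl] u[OF kl(1)] u[OF kl(2)] v[OF kl(1)] v[OF kl(2)]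
          schur_apply[OF n kl]
        using inva alt_entry[OF Ma kl] alt_entry[OF Ma n(1) kl(1)] alt_entry[OF Ma n(1) kl(2)]
          alt_entry[OF Ma n(2) kl(1)] alt_entry[OF Ma n(2) kl(2)] by algebra
    qed
  qed
  have "bij_betw f ?X ?Y"
  proof (rule bij_betw_byWitness)
    show "\<forall>M\<in>?X. g (f M) = M" using gf by blast
    show "\<forall>y\<in>?Y. f (g y) = y" by (intro ballI) (rule g_props[THEN conjunct2])
    show "f ` ?X \<subseteq> ?Y" by (intro image_subsetI) (rule f_in)
    show "g ` ?Y \<subseteq> ?X" by (intro image_subsetI) (rule g_props[THEN conjunct1])
  qed
  then have "card ?X = card ?Y" by (rule bij_betw_same_card)
  also have "\<dots> = (card (carrier R) - 1) * (card (carrier R) ^ card ?J * (card (carrier R) ^ card ?J * card (low_rank ?J r)))"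
    using fin finite_carrier by (simp add: card_cartesian_product card_PiE card_Diff_singleton)
  also have "card ?J = card I - 2" using ij fin by (simp add: card_Diff_subset)
  finally show ?thesis by (simp add: mult_2 power_add)
qed

text \<open>Union bound over the pivot positions, at most n^2 of them, plus the zero matrix: hence a
  factor 1 + n^2 per elimination step. As r drops by one, I loses two indices and s stays
  fixed.\<close>

lemma card_low_rank_upper:
  assumes "I \<subseteq> {..<n}" "card I = 2 * r + s"
  shows "card (low_rank I r) \<le> (1 + n\<^sup>2) ^ r * card (carrier R) ^ low_rank_dim r s"
  using assms
proof (induction r arbitrary: I)
  case 0
  then show ?case by (simp add: low_rank_0 low_rank_dim_def)
next
  case (Suc r)
  let ?q = "card (carrier R)"
  let ?P = "{(i, j). i \<in> I \<and> j \<in> I \<and> i \<noteq> j}"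
  let ?b = "(1 + n\<^sup>2) ^ r * ?q ^ low_rank_dim (Suc r) s"
  have fin: "finite I" using Suc.prems finite_subset by blast
  have fP: "finite ?P" by (rule finite_subset[of _ "I \<times> I"]) (use fin in auto)
  have "card ?P \<le> card (I \<times> I)" using fin by (intro card_mono) auto
  also have "\<dots> \<le> n * n"
    unfolding card_cartesian_product using Suc.prems(1) card_mono[of "{..<n}" I]
    by (intro mult_le_mono) auto
  finally have cP: "card ?P \<le> n\<^sup>2" by (simp add: power2_eq_square)
  have q: "?q \<ge> 1" using cols.card_K_ge_2 by simp
  have "low_rank I (Suc r) \<subseteq> {zero_mat} \<union> (\<Union>(i, j)\<in>?P. {M \<in> low_rank I (Suc r). M (i, j) \<noteq> \<zero>})"
  proof
    fix M assume M: "M \<in> low_rank I (Suc r)"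
    then have "M \<in> alt_on I" by (simp add: low_rank_def)
    then have "M = zero_mat \<or> (\<exists>i j. i \<in> I \<and> j \<in> I \<and> i \<noteq> j \<and> M (i, j) \<noteq> \<zero>)"
      using nonzero_entry by blast
    then show "M \<in> {zero_mat} \<union> (\<Union>(i, j)\<in>?P. {M \<in> low_rank I (Suc r). M (i, j) \<noteq> \<zero>})"
      using M by blast
  qed
  then have "card (low_rank I (Suc r))
      \<le> card ({zero_mat} \<union> (\<Union>(i, j)\<in>?P. {M \<in> low_rank I (Suc r). M (i, j) \<noteq> \<zero>}))"
    using fP finite_low_rank by (intro card_mono) auto
  also have "\<dots> \<le> 1 + card (\<Union>(i, j)\<in>?P. {M \<in> low_rank I (Suc r). M (i, j) \<noteq> \<zero>})"
    using card_Un_le[of "{zero_mat}"] by simp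
  also have "card (\<Union>(i, j)\<in>?P. {M \<in> low_rank I (Suc r). M (i, j) \<noteq> \<zero>})
      \<le> (\<Sum>(i, j)\<in>?P. card {M \<in> low_rank I (Suc r). M (i, j) \<noteq> \<zero>})"
    using card_UN_le[OF fP] by (simp add: case_prod_unfold)
  also have "\<dots> \<le> (\<Sum>(i, j)\<in>?P. ?b)"
  proof (intro sum_mono, clarify)
    fix i j assume ij: "i \<in> I" "j \<in> I" "i \<noteq> j"
    have c: "card (I - {i, j}) = 2 * r + s" using ij fin Suc.prems by (simp add: card_Diff_subset)
    have IH: "card (low_rank (I - {i, j}) r) \<le> (1 + n\<^sup>2) ^ r * ?q ^ low_rank_dim r s"
      by (rule Suc.IH) (use Suc.prems c in auto)
    have "card {M \<in> low_rank I (Suc r). M (i, j) \<noteq> \<zero>}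
        = (?q - 1) * ?q ^ (2 * (2 * r + s)) * card (low_rank (I - {i, j}) r)"
      using card_low_rank_pivot[OF Suc.prems(1) ij] Suc.prems(2) by simp
    also have "\<dots> \<le> ?q * ?q ^ (2 * (2 * r + s)) * ((1 + n\<^sup>2) ^ r * ?q ^ low_rank_dim r s)"
      using IH by (intro mult_le_mono) auto
    also have "\<dots> = ?b"
      by (simp add: low_rank_dim_def power_add mult_ac)
    finally show "card {M \<in> low_rank I (Suc r). M (i, j) \<noteq> \<zero>} \<le> ?b" .
  qed
  also have "\<dots> \<le> n\<^sup>2 * ?b" using cP by (simp add: case_prod_unfold)
  \<comment> \<open>The zero matrix is absorbed because 1 <= \<open>?b\<close>.\<close>
  also have "1 + n\<^sup>2 * ?b \<le> ?b + n\<^sup>2 * ?b" using q by simp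
  also have "\<dots> = (1 + n\<^sup>2) ^ Suc r * ?q ^ low_rank_dim (Suc r) s"
    by (simp add: algebra_simps)
  finally show ?case by simp
qed

text \<open>One fixed pivot position suffices from below; q <= 2 (q - 1) costs a factor 2 per
  elimination step.\<close>

lemma card_low_rank_lower:
  assumes "I \<subseteq> {..<n}" "card I = 2 * r + s"
  shows "card (carrier R) ^ low_rank_dim r s \<le> 2 ^ r * card (low_rank I r)"
  using assms
proof (induction r arbitrary: I)
  case 0
  then show ?case by (simp add: low_rank_0 low_rank_dim_def)
next
  case (Suc r)
  let ?q = "card (carrier R)"
  have fin: "finite I" using Suc.prems finite_subset by blast
  have "2 \<le> card I" using Suc.prems by simp
  then obtain i j where ij: "i \<in> I" "j \<in> I" "i \<noteq> j"
    by (metis obtain_subset_with_card_n card_2_iff insert_subset)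
  have c: "card (I - {i, j}) = 2 * r + s" using ij fin Suc.prems by (simp add: card_Diff_subset)
  have "?q ^ low_rank_dim (Suc r) s = ?q * ?q ^ (2 * (2 * r + s)) * ?q ^ low_rank_dim r s"
    by (simp add: low_rank_dim_def power_add mult_ac)
  also have "\<dots> \<le> (2 * (?q - 1)) * ?q ^ (2 * (2 * r + s)) * (2 ^ r * card (low_rank (I - {i, j}) r))"
    using cols.card_K_ge_2 Suc.prems c by (intro mult_le_mono Suc.IH) auto
  also have "\<dots> = 2 ^ Suc r * card {M \<in> low_rank I (Suc r). M (i, j) \<noteq> \<zero>}"
    using card_low_rank_pivot[OF Suc.prems(1) ij] Suc.prems(2) by simp
  also have "\<dots> \<le> 2 ^ Suc r * card (low_rank I (Suc r))"
    using finite_low_rank by (intro mult_le_mono card_mono) auto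
  finally show ?case .
qed

end

section \<open>Bounds for a fixed field\<close>

context finite_field_matrices
begin

text \<open>The entries below the diagonal are free and determine the rest; row j has j of them.
  Keeping the exponent as a sum avoids division of naturals.\<close>

lemma card_alt_mats: "card (alt_mats R n) = card (carrier R) ^ (\<Sum>j<n. j)"
proof -
  let ?T = "SIGMA j:{..<n}. {..<j}"
  define g where "g h = (\<lambda>(k, l)\<in>{..<n} \<times> {..<n}.
    if l < k then h (k, l) else if k < l then \<ominus> h (l, k) else \<zero>)" for h :: "nat \<times> nat \<Rightarrow> 'a"
  have T: "?T \<subseteq> {..<n} \<times> {..<n}" by auto
  have g_alt: "g h \<in> alt_mats R n" if h: "h \<in> ?T \<rightarrow>\<^sub>E carrier R" for h
  proof (rule alt_matsI)
    have hc: "h (k, l) \<in> carrier R" if "l < k" "k < n" for k l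
      using PiE_mem[OF h, of "(k, l)"] that by auto
    show "g h (k, l) \<in> carrier R" if "k < n" "l < n" for k l
      using that hc by (auto simp: g_def)
    show "g h (k, l) = \<ominus> g h (l, k)" if "k < n" "l < n" for k l
      using that hc by (auto simp: g_def)
  qed (auto simp: g_def)
  have res: "restrict M ?T \<in> ?T \<rightarrow>\<^sub>E carrier R" if "M \<in> alt_mats R n" for M
    unfolding restrict_PiE_iff using that by auto
  have "bij_betw (\<lambda>M. restrict M ?T) (alt_mats R n) (?T \<rightarrow>\<^sub>E carrier R)"
  proof (rule bij_betw_byWitness[where f' = g])
    show "\<forall>M\<in>alt_mats R n. g (restrict M ?T) = M"
    proof
      fix M assume M: "M \<in> alt_mats R n"
      note g_alt[OF res[OF M]]
      moreover have "g (restrict M ?T) (k, l) = M (k, l)" if kl: "k < n" "l < n" for k l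
        using kl M alt_swap[OF M kl] by (auto simp: g_def not_less_iff_gr_or_eq)
      ultimately show "g (restrict M ?T) = M" using M by (intro alt_eqI) auto
    qed
    show "\<forall>h\<in>?T \<rightarrow>\<^sub>E carrier R. restrict (g h) ?T = h"
    proof
      fix h assume "h \<in> ?T \<rightarrow>\<^sub>E carrier R"
      then show "restrict (g h) ?T = h"
        by (intro extensionalityI[of _ ?T]) (auto simp: g_def PiE_def)
    qed
    show "(\<lambda>M. restrict M ?T) ` alt_mats R n \<subseteq> ?T \<rightarrow>\<^sub>E carrier R"
      by (intro image_subsetI) (rule res)
    show "g ` (?T \<rightarrow>\<^sub>E carrier R) \<subseteq> alt_mats R n" using g_alt by blast
  qed
  then have "card (alt_mats R n) = card (?T \<rightarrow>\<^sub>E carrier R)" by (rule bij_betw_same_card)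
  then show ?thesis by (simp add: card_PiE)
qed

lemma mat_zero: "\<zero>\<^bsub>mat_space R n\<^esub> = zero_mat"
  by (simp add: mat_space_def func_space_def zero_mat_def)

lemma alt_mats_submodule: "LinearCombinations.submodule R (alt_mats R n) (mat_space R n)"
proof (rule submodule.intro)
  show "Module.module R (mat_space R n)" unfolding mat_space_def by (rule func_space_is_module)
  show "alt_mats R n \<subseteq> carrier (mat_space R n)" unfolding alt_mats_def by blast
  show "\<zero>\<^bsub>mat_space R n\<^esub> \<in> alt_mats R n" using mat_zero alt_onD(1)[OF zero_mat_alt_on] by simp
next
  fix M N assume M: "M \<in> alt_mats R n" and N: "N \<in> alt_mats R n"
  have *: "(M \<oplus>\<^bsub>mat_space R n\<^esub> N) (k, l) = M (k, l) \<oplus> N (k, l)" if "k < n" "l < n" for k l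
    using that by (simp add: mat_space_def func_space_def)
  show "M \<oplus>\<^bsub>mat_space R n\<^esub> N \<in> alt_mats R n"
  proof (rule alt_matsI)
    fix k l assume kl: "k < n" "l < n"
    show "(M \<oplus>\<^bsub>mat_space R n\<^esub> N) (k, l) \<in> carrier R" using kl M N by (simp add: *)
    show "(M \<oplus>\<^bsub>mat_space R n\<^esub> N) (k, l) = \<ominus> (M \<oplus>\<^bsub>mat_space R n\<^esub> N) (l, k)"
      unfolding *[OF kl] *[OF kl(2,1)] alt_swap[OF M kl] alt_swap[OF N kl]
      using alt_entry[OF M kl(2,1)] alt_entry[OF N kl(2,1)] by algebra
  qed (use M N in \<open>auto simp: *\<close>, simp add: mat_space_def func_space_def)
next
  fix c M assume c: "c \<in> carrier R" and M: "M \<in> alt_mats R n"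
  have *: "(c \<odot>\<^bsub>mat_space R n\<^esub> M) (k, l) = c \<otimes> M (k, l)" if "k < n" "l < n" for k l
    using that by (simp add: mat_space_def func_space_def)
  show "c \<odot>\<^bsub>mat_space R n\<^esub> M \<in> alt_mats R n"
  proof (rule alt_matsI)
    fix k l assume kl: "k < n" "l < n"
    show "(c \<odot>\<^bsub>mat_space R n\<^esub> M) (k, l) \<in> carrier R" using kl c M by (simp add: *)
    show "(c \<odot>\<^bsub>mat_space R n\<^esub> M) (k, l) = \<ominus> (c \<odot>\<^bsub>mat_space R n\<^esub> M) (l, k)"
      unfolding *[OF kl] *[OF kl(2,1)] alt_swap[OF M kl]
      using alt_entry[OF M kl(2,1)] c by algebra
  qed (use c M in \<open>auto simp: *\<close>, simp add: mat_space_def func_space_def)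
qed

lemma finite_vectorspace_alt_space: "finite_vectorspace R (alt_space R n)"
proof -
  interpret mats: vectorspace R "mat_space R n"
    unfolding mat_space_def by (rule vectorspace_func_space)
  have "VectorSpace.subspace R (alt_mats R n) (mat_space R n)"
    using alt_mats_submodule mats.vectorspace_axioms by (simp add: VectorSpace.subspace_def)
  then interpret alts: vectorspace R "alt_space R n"
    unfolding alt_space_def by (rule mats.subspace_is_vs)
  show ?thesis
    by unfold_locales (use finite_carrier finite_alt_mats in \<open>simp_all add: alt_space_def\<close>)
qed

sublocale alts: finite_vectorspace R "alt_space R n"
  by (rule finite_vectorspace_alt_space)

lemma dim_alt_space: "alts.dim = (\<Sum>j<n. j)"
proof -
  have "card (carrier R) ^ alts.dim = card (carrier R) ^ (\<Sum>j<n. j)"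
    using alts.card_carrier card_alt_mats by (simp add: alt_space_def)
  then show ?thesis using cols.card_K_ge_2 by (simp only: power_inject_exp)
qed

lemma alt_subspaces_eq: "alt_subspaces R n k = alts.subspaces k"
  by (simp add: alt_subspaces_def alts.subspaces_def)

text \<open>The set S of the moment bounds; zero is excluded since every subspace contains
  it.\<close>

definition low_rank_nonzero :: "nat \<Rightarrow> (nat \<times> nat \<Rightarrow> 'a) set" where
  "low_rank_nonzero r = low_rank {..<n} r - {zero_mat}"

lemma alt_zero: "\<zero>\<^bsub>alt_space R n\<^esub> = zero_mat"
  using mat_zero by (simp add: alt_space_def)

lemma mem_low_rank_nonzero:
  "M \<in> low_rank_nonzero r \<longleftrightarrow> M \<in> alt_mats R n \<and> M \<noteq> zero_mat \<and> mat_rank R n M < 2 * r + 2"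
proof -
  have "alt_on {..<n} = alt_mats R n" by (simp add: alt_on_def)
  then show ?thesis
    using mat_rank_less_iff[of M "2 * r + 2"] by (auto simp: low_rank_nonzero_def low_rank_def)
qed

lemma low_rank_nonzero_subset: "low_rank_nonzero r \<subseteq> carrier (alt_space R n) - {\<zero>\<^bsub>alt_space R n\<^esub>}"
  unfolding alt_zero by (auto simp: mem_low_rank_nonzero alt_space_def)

lemma card_low_rank_nonzero: "card (low_rank_nonzero r) = card (low_rank {..<n} r) - 1"
  unfolding low_rank_nonzero_def using zero_mat_low_rank finite_low_rank
  by (simp add: card_Diff_singleton)

lemma delta_Alt_eq:
  "delta_Alt R n k (2 * r + 2) = real (card {W \<in> alts.subspaces k. W \<inter> low_rank_nonzero r = {}})
    / real (card (alts.subspaces k))"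
proof -
  have "(\<forall>M\<in>W. M \<noteq> zero_mat \<longrightarrow> 2 * r + 2 \<le> mat_rank R n M) \<longleftrightarrow> W \<inter> low_rank_nonzero r = {}"
    if "W \<in> alts.subspaces k" for W
  proof -
    have "VectorSpace.subspace R W (alt_space R n)" using that unfolding alts.subspaces_def by simp
    from alts.subspace_subset[OF this] have "W \<subseteq> alt_mats R n" by (simp add: alt_space_def)
    then show ?thesis using mem_low_rank_nonzero by (auto simp: not_less[symmetric])
  qed
  then have "{W \<in> alts.subspaces k. \<forall>M\<in>W. M \<noteq> zero_mat \<longrightarrow> 2 * r + 2 \<le> mat_rank R n M}
    = {W \<in> alts.subspaces k. W \<inter> low_rank_nonzero r = {}}" by blast
  then show ?thesis unfolding delta_Alt_def alt_subspaces_eq alt_zero by simp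
qed

text \<open>Provides the cone condition of \<open>alts.card_meeting_subspaces_le\<close>. One
  inclusion of column spaces suffices, as the rank only must not grow; invertibility of c keeps the
  matrix nonzero.\<close>

lemma smult_low_rank_nonzero:
  assumes c: "c \<in> carrier R - {\<zero>}" and M: "M \<in> low_rank_nonzero r"
  shows "c \<odot>\<^bsub>alt_space R n\<^esub> M \<in> low_rank_nonzero r"
proof -
  let ?N = "c \<odot>\<^bsub>alt_space R n\<^esub> M"
  have Ma: "M \<in> alt_mats R n" using M mem_low_rank_nonzero by blast
  have N: "?N \<in> alt_mats R n"
    using submodule.smult_closed[OF alt_mats_submodule, of c M] c Ma by (simp add: alt_space_def)
  have cM: "M \<in> carrier (alt_space R n)" "M \<noteq> \<zero>\<^bsub>alt_space R n\<^esub>"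
    using M low_rank_nonzero_subset by auto
  have "?N \<noteq> zero_mat"
  proof
    assume "?N = zero_mat"
    then have "M = inv c \<odot>\<^bsub>alt_space R n\<^esub> \<zero>\<^bsub>alt_space R n\<^esub>"
      using alts.mult_inverse[OF _ cM(1), of c "\<zero>\<^bsub>alt_space R n\<^esub>"] c alt_zero by auto
    then show False using c cM by simp
  qed
  moreover have "card (col_space ?N) \<le> card (col_space M)"
  proof (rule card_mono)
    let ?C = "mat_column n M ` {..<n}"
    have C: "?C \<subseteq> carrier col_vectors" using mat_column_in[OF Ma] by auto
    show "finite (col_space M)" unfolding col_space_def by (rule cols.finite_span_subset[OF C])
    have sm: "LinearCombinations.submodule R (cols.span ?C) col_vectors"
      by (rule cols.span_is_submodule[OF C])
    have "mat_column n ?N l = c \<odot>\<^bsub>col_vectors\<^esub> mat_column n M l" if "l < n" for l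
      using that by (auto simp: mat_column_def func_space_def alt_space_def mat_space_def)
    moreover have "mat_column n M l \<in> cols.span ?C" if "l < n" for l
      using cols.span_mem[OF C] that by auto
    ultimately have "mat_column n ?N ` {..<n} \<subseteq> cols.span ?C"
      using submodule.smult_closed[OF sm] c by auto
    then show "col_space ?N \<subseteq> col_space M"
      unfolding col_space_def using sm by (rule cols.span_is_subset)
  qed
  ultimately show ?thesis
    using N Ma M mat_rank_less_iff[OF N, of "2 * r + 2"] mat_rank_less_iff[OF Ma, of "2 * r + 2"]
    by (auto simp: mem_low_rank_nonzero)
qed

lemma delta_Alt_le_1: "delta_Alt R n k (2 * r + 2) \<le> 1"
proof -
  have "card {W \<in> alts.subspaces k. W \<inter> low_rank_nonzero r = {}} \<le> card (alts.subspaces k)"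
    using alts.finite_subspaces by (intro card_mono) auto
  then show ?thesis unfolding delta_Alt_eq by (auto simp: divide_le_eq)
qed

text \<open>Chebyshev gives delta |S| p <= q; then |S| >= q^D / 2^(r + 1) and p >= q^(k - N) / 2
  account for the constant 2^(r + 2). Multiplying out keeps all exponents natural. For r = 0 the set
  S would be empty and Chebyshev would say nothing.\<close>

lemma delta_Alt_upper:
  assumes k: "1 \<le> k" "k \<le> (\<Sum>j<n. j)" and r: "1 \<le> r" "2 * r + s = n"
    and q: "2 ^ (r + 1) \<le> card (carrier R)"
  shows "delta_Alt R n k (2 * r + 2) * real (card (carrier R)) ^ (low_rank_dim r s + k)
    \<le> 2 ^ (r + 2) * real (card (carrier R)) ^ ((\<Sum>j<n. j) + 1)"
proof -
  define Q where "Q = real (card (carrier R))"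
  let ?N = "\<Sum>j<n. j" and ?D = "low_rank_dim r s" and ?S = "low_rank_nonzero r"
  let ?\<delta> = "delta_Alt R n k (2 * r + 2)" and ?p = "alts.incidence_prob k"
  have Q: "Q \<ge> 2" using cols.card_K_ge_2 by (simp add: Q_def)
  have kd: "k \<le> alts.dim" using k by (simp add: dim_alt_space)
  have a: "real (card (alts.subspaces k)) > 0" using alts.subspaces_nonempty[OF kd] by simp
  have \<delta>0: "0 \<le> ?\<delta>" unfolding delta_Alt_eq by simp
  have 1: "?\<delta> * (real (card ?S) * ?p) \<le> Q"
  proof -
    have "real (card {W \<in> alts.subspaces k. W \<inter> ?S = {}}) * (real (card ?S) * ?p)
      \<le> (Q - 1) * real (card (alts.subspaces k))"
      unfolding Q_def by (rule alts.card_avoiding_subspaces_le[OF low_rank_nonzero_subset k(1) kd])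
    then have "?\<delta> * (real (card ?S) * ?p) \<le> Q - 1"
      unfolding delta_Alt_eq using a by (simp add: field_simps)
    then show ?thesis by simp
  qed
  have 2: "Q ^ k / Q ^ ?N \<le> 2 * ?p"
    using alts.incidence_prob_lower[OF k(1) kd] by (simp add: Q_def dim_alt_space)
  have 3: "Q ^ ?D \<le> 2 ^ (r + 1) * real (card ?S)"
  proof -
    \<comment> \<open>A positive D gives q <= q^D, so the assumed lower bound on q is one on q^D
      too.\<close>
    have "0 < ?D" using r by (cases r) (auto simp: low_rank_dim_def lessThan_Suc)
    then have "card (carrier R) ^ 1 \<le> card (carrier R) ^ ?D"
      using cols.card_K_ge_2 by (intro power_increasing) auto
    then have big: "2 ^ (r + 1) \<le> card (carrier R) ^ ?D" using q by simp
    have low: "card (carrier R) ^ ?D \<le> 2 ^ r * card (low_rank {..<n} r)"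
      by (rule card_low_rank_lower) (use r in auto)
    have "card (low_rank {..<n} r) \<ge> 1"
      using zero_mat_low_rank finite_low_rank by (metis One_nat_def Suc_leI card_gt_0_iff empty_iff)
    then have cS: "real (card ?S) = real (card (low_rank {..<n} r)) - 1"
      by (simp add: card_low_rank_nonzero)
    have "real (2 ^ (r + 1)) \<le> real (card (carrier R) ^ ?D)" using big by (simp only: of_nat_le_iff)
    then have b: "2 * 2 ^ r \<le> Q ^ ?D" by (simp add: Q_def)
    have "real (card (carrier R) ^ ?D) \<le> real (2 ^ r * card (low_rank {..<n} r))"
      using low by (simp only: of_nat_le_iff)
    then have l: "Q ^ ?D \<le> 2 ^ r * real (card (low_rank {..<n} r))" by (simp add: Q_def)
    \<comment> \<open>Dropping the zero matrix costs 2 * 2^r, which is at most q^D; the doubled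
      count is at least 2 q^D and can afford it.\<close>
    have "2 ^ (r + 1) * real (card ?S) = 2 * (2 ^ r * real (card (low_rank {..<n} r))) - 2 * 2 ^ r"
      unfolding cS by (simp add: algebra_simps)
    then show ?thesis using b l by argo
  qed
  have "?\<delta> * (Q ^ ?D * (Q ^ k / Q ^ ?N)) \<le> ?\<delta> * ((2 ^ (r + 1) * real (card ?S)) * (2 * ?p))"
    using \<delta>0 2 3 Q by (intro mult_left_mono mult_mono) auto
  also have "\<dots> = 2 ^ (r + 2) * (?\<delta> * (real (card ?S) * ?p))" by simp
  also have "\<dots> \<le> 2 ^ (r + 2) * Q" using 1 by (intro mult_left_mono) auto
  finally have "?\<delta> * (Q ^ ?D * (Q ^ k / Q ^ ?N)) * Q ^ ?N \<le> 2 ^ (r + 2) * Q * Q ^ ?N"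
    using Q by (intro mult_right_mono) auto
  then show ?thesis using Q unfolding Q_def[symmetric] by (simp add: power_add mult_ac)
qed

text \<open>Markov gives (q - 1) (1 - delta) <= |S| p. The factor 2 comes from q <= 2 (q - 1), and
  the power of 1 + n^2 from the count of low-rank matrices.\<close>

lemma delta_Alt_lower:
  assumes k: "1 \<le> k" "k \<le> (\<Sum>j<n. j)" and r: "2 * r + s = n"
  shows "(1 - delta_Alt R n k (2 * r + 2)) * real (card (carrier R)) ^ ((\<Sum>j<n. j) + 1)
    \<le> 2 * (1 + real n ^ 2) ^ r * real (card (carrier R)) ^ (low_rank_dim r s + k)"
proof -
  define Q where "Q = real (card (carrier R))"
  let ?N = "\<Sum>j<n. j" and ?D = "low_rank_dim r s" and ?S = "low_rank_nonzero r"
  let ?\<delta> = "delta_Alt R n k (2 * r + 2)" and ?p = "alts.incidence_prob k"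
  have Q: "Q \<ge> 2" using cols.card_K_ge_2 by (simp add: Q_def)
  have kd: "k \<le> alts.dim" using k by (simp add: dim_alt_space)
  have a: "real (card (alts.subspaces k)) > 0" using alts.subspaces_nonempty[OF kd] by simp
  have 1: "(Q - 1) * (1 - ?\<delta>) \<le> real (card ?S) * ?p"
  proof -
    let ?G = "{W \<in> alts.subspaces k. W \<inter> ?S = {}}" and ?B = "{W \<in> alts.subspaces k. W \<inter> ?S \<noteq> {}}"
    have "card (alts.subspaces k) = card (?G \<union> ?B)" by (rule arg_cong[of _ _ card]) auto
    also have "\<dots> = card ?G + card ?B"
      using alts.finite_subspaces by (intro card_Un_disjoint) auto
    finally have "real (card ?B) = (1 - ?\<delta>) * real (card (alts.subspaces k))"
      unfolding delta_Alt_eq using a by (simp add: field_simps)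
    moreover have "(Q - 1) * real (card ?B) \<le> real (card ?S) * ?p * real (card (alts.subspaces k))"
      unfolding Q_def by (rule alts.card_meeting_subspaces_le[OF low_rank_nonzero_subset k(1) kd smult_low_rank_nonzero])
    ultimately have "((Q - 1) * (1 - ?\<delta>)) * real (card (alts.subspaces k))
      \<le> (real (card ?S) * ?p) * real (card (alts.subspaces k))" by (simp add: mult_ac)
    then show ?thesis using a by (simp only: mult_le_cancel_right_pos)
  qed
  have 2: "?p \<le> Q ^ k / Q ^ ?N"
    using alts.incidence_prob_upper[OF k(1) kd] by (simp add: Q_def dim_alt_space)
  have 3: "real (card ?S) \<le> (1 + real n ^ 2) ^ r * Q ^ ?D"
  proof -
    have "card ?S \<le> (1 + n\<^sup>2) ^ r * card (carrier R) ^ ?D"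
      using card_low_rank_upper[of "{..<n}" r s] r card_low_rank_nonzero[of r] by simp
    then have "real (card ?S) \<le> real ((1 + n\<^sup>2) ^ r * card (carrier R) ^ ?D)" by (simp only: of_nat_le_iff)
    then show ?thesis by (simp add: Q_def)
  qed
  have "Q * (1 - ?\<delta>) \<le> (2 * (Q - 1)) * (1 - ?\<delta>)"
    using Q delta_Alt_le_1[of k r] by (intro mult_right_mono) auto
  also have "\<dots> = 2 * ((Q - 1) * (1 - ?\<delta>))" by simp
  also have "\<dots> \<le> 2 * (((1 + real n ^ 2) ^ r * Q ^ ?D) * (Q ^ k / Q ^ ?N))"
    using 1 2 3 alts.incidence_prob_nonneg[of k] Q
    by (intro mult_left_mono order_trans[OF 1] mult_mono) auto
  finally have "Q * (1 - ?\<delta>) * Q ^ ?N \<le> 2 * (((1 + real n ^ 2) ^ r * Q ^ ?D) * (Q ^ k / Q ^ ?N)) * Q ^ ?N"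
    using Q by (intro mult_right_mono) auto
  then show ?thesis using Q unfolding Q_def[symmetric] by (simp add: power_add mult_ac)
qed

end

section \<open>Asymptotics\<close>

text \<open>With n = 2 r + s this is r (2 n - 2 r - 1), which for d = 2 r + 2 equals (d - 2) n - (d
  - 1) (d - 2) / 2, the correction in the theorem's exponent.\<close>

lemma real_low_rank_dim: "real (low_rank_dim r s) = real r * (2 * real r + 2 * real s - 1)"
  unfolding low_rank_dim_def by (induction r) (auto simp: algebra_simps)

lemma real_sum_lessThan: "real (\<Sum>j<n. j) = real n * (real n - 1) / 2"
  by (induction n) (auto simp: field_simps)

text \<open>The filter of prime powers is finer than \<open>sequentially\<close>, so limits along
  all naturals carry over.\<close>

lemma powr_tendsto_0_prime_powers:
  assumes "x < 0"
  shows "((\<lambda>q. C * real q powr x) \<longlongrightarrow> 0) prime_powers_at_top"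
proof -
  have "((\<lambda>q. real q powr x) \<longlongrightarrow> 0) sequentially"
    by (rule tendsto_neg_powr[OF assms filterlim_real_sequentially])
  then have "((\<lambda>q. C * real q powr x) \<longlongrightarrow> C * 0) sequentially" by (intro tendsto_intros)
  then show ?thesis unfolding prime_powers_at_top_def by (intro tendsto_mono[OF inf_le1]) simp
qed

lemma eventually_prime_powers_at_topI:
  assumes "\<And>q. primepow q \<Longrightarrow> c \<le> q \<Longrightarrow> P q"
  shows "eventually P prime_powers_at_top"
  unfolding prime_powers_at_top_def eventually_inf_principal
  using eventually_ge_at_top[of c] by eventually_elim (use assms in auto)

theorem theorem6p15:
  fixes F :: "nat \<Rightarrow> 'a ring"
    and n d e t k :: nat
  assumes F_field: "\<And>q. primepow q \<Longrightarrow> field (F q)"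
    and F_card: "\<And>q. primepow q \<Longrightarrow> card (carrier (F q)) = q"
    and n: "2 \<le> n"
    and d: "2 \<le> d" "d \<le> n" "d = 2 * e"
    and t: "t = n div 2"
    and k: "1 \<le> k"
      "real k \<le> real n * (real n - 1) / (2 * real t) * (real t - real e + 1)"
  shows "(\<lambda>q. delta_Alt (F q) n k d) \<in> O[prime_powers_at_top](\<lambda>q. real q powr
            (real n * (real n - 1) / 2 - real k + 1 - (real d - 2) * real n
              + (real d - 1) * (real d - 2) / 2))
    \<and> (real k < real n * (real n - 1) / 2 + 1 - (real d - 2) * real n
              + (real d - 1) * (real d - 2) / 2
        \<longrightarrow> ((\<lambda>q. delta_Alt (F q) n k d) \<longlongrightarrow> 1) prime_powers_at_top)
    \<and> (real k > real n * (real n - 1) / 2 + 1 - (real d - 2) * real n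
              + (real d - 1) * (real d - 2) / 2
        \<longrightarrow> ((\<lambda>q. delta_Alt (F q) n k d) \<longlongrightarrow> 0) prime_powers_at_top)"
proof -
  \<comment> \<open>Half the largest even rank below d; s then counts the indices left after r
    elimination steps.\<close>
  define r where "r = e - 1"
  define s where "s = n - 2 * r"
  let ?N = "\<Sum>j<n. j" and ?D = "low_rank_dim r s" and ?\<delta> = "\<lambda>q. delta_Alt (F q) n k d"
  define x where "x = real n * (real n - 1) / 2 - real k + 1 - (real d - 2) * real n
    + (real d - 1) * (real d - 2) / 2"
  have e: "1 \<le> e" "2 * e \<le> n" using d by auto
  have dr: "d = 2 * r + 2" using d e by (simp add: r_def)
  have rs: "2 * r + s = n" using e by (simp add: s_def r_def)
  \<comment> \<open>Minus the exponent of the expected number of low-rank lines.\<close>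
  have x_eq: "x = real ?N + 1 - real k - real ?D"
  proof -
    have "real n = 2 * real r + real s" using rs by linarith
    then show ?thesis
      unfolding x_def real_sum_lessThan real_low_rank_dim by (simp add: dr field_simps)
  qed
  \<comment> \<open>As e >= 1, the factor t - e + 1 is at most t, which cancels against the
    denominator: k is at most the dimension of the whole space.\<close>
  have kN: "k \<le> ?N"
  proof -
    have t1: "1 \<le> real t" using t n by simp
    have "real n * (real n - 1) / (2 * real t) * (real t - real e + 1)
        \<le> real n * (real n - 1) / (2 * real t) * real t"
      using n e by (intro mult_left_mono) auto
    also have "\<dots> = real ?N" unfolding real_sum_lessThan using t1 by simp
    finally have "real k \<le> real ?N" using k(2) by linarith
    then show ?thesis by (simp only: of_nat_le_iff)
  qed
  have loc: "finite_field_matrices (F q)" if "primepow q" for q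
  proof -
    have "finite (carrier (F q))"
      using F_card[OF that] primepow_gt_0_nat[OF that] by (simp add: card_ge_0_finite)
    then show ?thesis using F_field[OF that]
      by (simp add: finite_field_matrices_def finite_field_matrices_axioms_def)
  qed
  have le1: "?\<delta> q \<le> 1" if "primepow q" for q
    using finite_field_matrices.delta_Alt_le_1[OF loc[OF that]] by (simp add: dr)
  have ge0: "0 \<le> ?\<delta> q" for q by (simp add: delta_Alt_def)
  \<comment> \<open>Real powers are used from here on because the difference of exponents may be
    negative.\<close>
  have cancel: "y \<le> C * real q powr (real b - real a)"
    if "primepow q" "y * real q ^ a \<le> C * real q ^ b" for a b q :: nat and y C :: real
  proof -
    have q: "0 < real q" using primepow_gt_0_nat[OF that(1)] by simp
    then show ?thesis using that(2)
      by (simp add: powr_diff powr_realpow field_simps)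
  qed
  have upper: "?\<delta> q \<le> 2 ^ (r + 2) * real q powr x"
    if "primepow q" "2 ^ (r + 1) \<le> q" "1 \<le> r" for q
  proof -
    have "?\<delta> q * real q ^ (?D + k) \<le> 2 ^ (r + 2) * real q ^ (?N + 1)"
      using finite_field_matrices.delta_Alt_upper[OF loc[OF that(1)] k(1) kN that(3) rs] that
        F_card[OF that(1)] by (simp add: dr)
    from cancel[OF that(1) this] show ?thesis by (simp add: x_eq algebra_simps)
  qed
  have lower: "1 - ?\<delta> q \<le> 2 * (1 + real n ^ 2) ^ r * real q powr (- x)" if "primepow q" for q
  proof -
    have "(1 - ?\<delta> q) * real q ^ (?N + 1) \<le> 2 * (1 + real n ^ 2) ^ r * real q ^ (?D + k)"
      using finite_field_matrices.delta_Alt_lower[OF loc[OF that(1)] k(1) kN rs]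
        F_card[OF that(1)] by (simp add: dr)
    from cancel[OF that(1) this] show ?thesis by (simp add: x_eq algebra_simps)
  qed
  \<comment> \<open>For d = 2 the sum D is empty and x = N + 1 - k. Then q^x >= 1, and the trivial
    bound delta <= 1 takes the place of Chebyshev.\<close>
  have x0: "1 \<le> x" if "r = 0"
  proof -
    have "real k \<le> real ?N" using kN by (simp only: of_nat_le_iff)
    then show ?thesis using that x_eq by (simp add: low_rank_dim_def)
  qed
  have ex_upper: "\<exists>c. \<forall>q. primepow q \<longrightarrow> c \<le> q \<longrightarrow> ?\<delta> q \<le> 2 ^ (r + 2) * real q powr x"
  proof (cases "r = 0")
    case True
    have "?\<delta> q \<le> 2 ^ (r + 2) * real q powr x" if "primepow q" for q
    proof -
      have "1 \<le> real q powr x"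
        using x0[OF True] primepow_gt_0_nat[OF that] by (intro ge_one_powr_ge_zero) auto
      then show ?thesis using le1[OF that] True by simp
    qed
    then show ?thesis by blast
  next
    case False
    then show ?thesis using upper by (intro exI[of _ "2 ^ (r + 1)"]) simp
  qed
  have ev_upper: "eventually (\<lambda>q. ?\<delta> q \<le> 2 ^ (r + 2) * real q powr x) prime_powers_at_top"
  proof -
    obtain c where "\<forall>q. primepow q \<longrightarrow> c \<le> q \<longrightarrow> ?\<delta> q \<le> 2 ^ (r + 2) * real q powr x"
      using ex_upper by (elim exE)
    then show ?thesis by (intro eventually_prime_powers_at_topI[of c]) simp
  qed
  have "?\<delta> \<in> O[prime_powers_at_top](\<lambda>q. real q powr x)"
  proof (rule bigoI)
    show "eventually (\<lambda>q. norm (?\<delta> q) \<le> 2 ^ (r + 2) * norm (real q powr x)) prime_powers_at_top"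
      using ev_upper by eventually_elim (use ge0 in auto)
  qed
  moreover have "(?\<delta> \<longlongrightarrow> 1) prime_powers_at_top" if "0 < x"
  proof -
    have "((\<lambda>q. 1 - ?\<delta> q) \<longlongrightarrow> 0) prime_powers_at_top"
    proof (rule tendsto_sandwich)
      show "eventually (\<lambda>q. 0 \<le> 1 - ?\<delta> q) prime_powers_at_top"
        by (rule eventually_prime_powers_at_topI[of 0]) (use le1 in auto)
      show "eventually (\<lambda>q. 1 - ?\<delta> q \<le> 2 * (1 + real n ^ 2) ^ r * real q powr (- x)) prime_powers_at_top"
        by (rule eventually_prime_powers_at_topI[of 0]) (use lower in auto)
      show "((\<lambda>q. 2 * (1 + real n ^ 2) ^ r * real q powr (- x)) \<longlongrightarrow> 0) prime_powers_at_top"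
        by (rule powr_tendsto_0_prime_powers) (use that in simp)
    qed simp
    from tendsto_diff[OF tendsto_const[of 1] this] show ?thesis by simp
  qed
  moreover have "(?\<delta> \<longlongrightarrow> 0) prime_powers_at_top" if "x < 0"
  proof (rule tendsto_sandwich)
    show "eventually (\<lambda>q. 0 \<le> ?\<delta> q) prime_powers_at_top" using ge0 by simp
    show "eventually (\<lambda>q. ?\<delta> q \<le> 2 ^ (r + 2) * real q powr x) prime_powers_at_top" by (rule ev_upper)
    show "((\<lambda>q. 2 ^ (r + 2) * real q powr x) \<longlongrightarrow> 0) prime_powers_at_top"
      by (rule powr_tendsto_0_prime_powers[OF that])
  qed simp
  ultimately show ?thesis unfolding x_def by argo
qed

end
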